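(* Let $\Omega\subseteq M^2$ be a simply connected domain of a connected Riemannian surface $M^2$. There exists a non-trivial solution $u\in\mathcal{C}^\infty(\Omega)$ to the minimal surface equation on $\Omega$, $$\mathrm{Div}\left(\frac{Du}{\sqrt{1+|Du|^2}}\right)=0,$$ if and only if there exists a non-trivial solution $w\in\mathcal{C}^\infty(\Omega)$ to the maximal surface equation on $\Omega$, $$\mathrm{Div}\left(\frac{Dw}{\sqrt{1-|Dw|^2}}\right)=0,\qquad |Dw|^2<1.$$
   Context: Here $D$ applied to a function denotes its gradient, and $|\cdot|$ and $\mathrm{Div}$ denote the norm and divergence on $\Omega$, all with respect to the Riemannian metric of $M$. A non-trivial solution of either equation is a smooth solution on $\Omega$ whose gradient is not parallel on $\Omega$ with respect to the Levi-Civita connection of the metric of $M$. A domain is a connected open subset. *)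

theory Defs
  imports "HOL-Analysis.Analysis"
begin

section \<open>Smooth functions on open sets\<close>

text \<open>Iterated directional derivatives. On open subsets of a finite-dimensional space this is
  the class of \<open>k\<close> times continuously differentiable functions.\<close>

primrec Ck_on ::
  "nat \<Rightarrow> 'a::real_normed_vector set \<Rightarrow> ('a \<Rightarrow> 'b::real_normed_vector) \<Rightarrow> bool" where
  "Ck_on 0 S f \<longleftrightarrow> continuous_on S f"
| "Ck_on (Suc k) S f \<longleftrightarrow>
     (\<forall>x\<in>S. f differentiable (at x)) \<and> (\<forall>v. Ck_on k S (\<lambda>x. frechet_derivative f (at x) v))"

definition smooth_on ::
  "'a::real_normed_vector set \<Rightarrow> ('a \<Rightarrow> 'b::real_normed_vector) \<Rightarrow> bool" where
  "smooth_on S f \<longleftrightarrow> (\<forall>k. Ck_on k S f)"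

definition partial :: "2 \<Rightarrow> (real^2 \<Rightarrow> real) \<Rightarrow> real^2 \<Rightarrow> real" where
  "partial i f x = frechet_derivative f (at x) (axis i 1)"


section \<open>Riemannian surfaces\<close>

datatype 'a chart = Chart (chart_dom: "'a set") (chart_map: "'a \<Rightarrow> real^2")

definition chart_inv :: "'a chart \<Rightarrow> real^2 \<Rightarrow> 'a" where
  "chart_inv c = inv_into (chart_dom c) (chart_map c)"

text \<open>The surface \<open>M\<close> carries the subspace topology of the ambient type, so that it is Hausdorff
  and second countable. The atlas \<open>A\<close> need not be maximal. The metric is given by its
  coefficients: the matrix \<open>g c x\<close> has the entries
  \<open>\<langle>\<partial>/\<partial>x\<^sub>i, \<partial>/\<partial>x\<^sub>j\<rangle>\<close> at the point with coordinates \<open>x\<close> in the chart \<open>c\<close>;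
  its values for \<open>x\<close> outside the image of \<open>c\<close> are irrelevant.\<close>

locale riemannian_surface =
  fixes M :: "'a::{t2_space,second_countable_topology} set"
    and A :: "'a chart set"
    and g :: "'a chart \<Rightarrow> real^2 \<Rightarrow> real^2^2"
  assumes covers: "(\<Union>c\<in>A. chart_dom c) = M"
    and dom_open: "c \<in> A \<Longrightarrow> openin (top_of_set M) (chart_dom c)"
    and image_open: "c \<in> A \<Longrightarrow> open (chart_map c ` chart_dom c)"
    and chart_homeomorphism:
      "c \<in> A \<Longrightarrow>
        homeomorphism (chart_dom c) (chart_map c ` chart_dom c) (chart_map c) (chart_inv c)"
    and transition_smooth:
      "\<lbrakk>c \<in> A; d \<in> A\<rbrakk> \<Longrightarrow>
        smooth_on (chart_map c ` (chart_dom c \<inter> chart_dom d)) (chart_map d \<circ> chart_inv c)"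
    and metric_smooth: "c \<in> A \<Longrightarrow> smooth_on (chart_map c ` chart_dom c) (g c)"
    and metric_symmetric:
      "\<lbrakk>c \<in> A; x \<in> chart_map c ` chart_dom c\<rbrakk> \<Longrightarrow> transpose (g c x) = g c x"
    and metric_positive:
      "\<lbrakk>c \<in> A; x \<in> chart_map c ` chart_dom c; v \<noteq> 0\<rbrakk> \<Longrightarrow> v \<bullet> (g c x *v v) > 0"
    and metric_transformation:
      "\<lbrakk>c \<in> A; d \<in> A; p \<in> chart_dom c \<inter> chart_dom d;
        J = matrix (frechet_derivative (chart_map d \<circ> chart_inv c) (at (chart_map c p)))\<rbrakk> \<Longrightarrow>
        g c (chart_map c p) = transpose J ** g d (chart_map d p) ** J"

definition smooth_fun :: "'a chart set \<Rightarrow> 'a set \<Rightarrow> ('a \<Rightarrow> real) \<Rightarrow> bool" where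
  "smooth_fun A \<Omega> u \<longleftrightarrow>
     (\<forall>c\<in>A. smooth_on (chart_map c ` (chart_dom c \<inter> \<Omega>)) (u \<circ> chart_inv c))"


section \<open>Riemannian operators in a chart\<close>

text \<open>In this section \<open>h\<close> is the matrix of metric coefficients in one chart, and functions and
  vector fields are given by their coordinate expressions. The gradient is the vector field with
  components \<open>\<Sum>\<^sub>j h\<^sup>i\<^sup>j \<partial>\<^sub>j f\<close>.\<close>

definition gradient :: "(real^2 \<Rightarrow> real^2^2) \<Rightarrow> (real^2 \<Rightarrow> real) \<Rightarrow> real^2 \<Rightarrow> real^2" where
  "gradient h f x = matrix_inv (h x) *v (\<chi> j. partial j f x)"

definition metric_norm :: "(real^2 \<Rightarrow> real^2^2) \<Rightarrow> real^2 \<Rightarrow> real^2 \<Rightarrow> real" where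
  "metric_norm h x v = sqrt (v \<bullet> (h x *v v))"

text \<open>\<open>christoffel h k i j\<close> is the Christoffel symbol of the Levi-Civita connection with upper
  index \<open>k\<close> and lower indices \<open>i\<close>, \<open>j\<close>.\<close>

definition christoffel :: "(real^2 \<Rightarrow> real^2^2) \<Rightarrow> 2 \<Rightarrow> 2 \<Rightarrow> 2 \<Rightarrow> real^2 \<Rightarrow> real" where
  "christoffel h k i j x =
     (1/2) * (\<Sum>l\<in>UNIV. matrix_inv (h x) $ k $ l *
       (partial i (\<lambda>y. h y $ j $ l) x + partial j (\<lambda>y. h y $ i $ l) x
         - partial l (\<lambda>y. h y $ i $ j) x))"

text \<open>\<open>cov_deriv h X j i\<close> is the \<open>i\<close>-th component of the covariant derivative of \<open>X\<close> in the
  direction of the \<open>j\<close>-th coordinate vector field.\<close>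

definition cov_deriv ::
  "(real^2 \<Rightarrow> real^2^2) \<Rightarrow> (real^2 \<Rightarrow> real^2) \<Rightarrow> 2 \<Rightarrow> 2 \<Rightarrow> real^2 \<Rightarrow> real" where
  "cov_deriv h X j i x =
     partial j (\<lambda>y. X y $ i) x + (\<Sum>k\<in>UNIV. christoffel h i j k x * X x $ k)"

text \<open>The divergence is the trace of the covariant derivative.\<close>

definition divergence :: "(real^2 \<Rightarrow> real^2^2) \<Rightarrow> (real^2 \<Rightarrow> real^2) \<Rightarrow> real^2 \<Rightarrow> real" where
  "divergence h X x = (\<Sum>i\<in>UNIV. cov_deriv h X i i x)"

lemma matrix_inv_inverse:
  fixes B :: "real^2^2"
  assumes "invertible B"
  shows "B ** matrix_inv B = mat 1" "matrix_inv B ** B = mat 1"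
  using someI_ex [OF assms [unfolded invertible_def]] by (simp_all add: matrix_inv_def)

text \<open>\<open>\<langle>Df, v\<rangle> = df(v)\<close> for the gradient just defined, and the connection given by the Christoffel
  symbols is torsion free and compatible with the metric.\<close>

lemma gradient_characterization:
  assumes "invertible (h x)" "f differentiable (at x)"
  shows "v \<bullet> (h x *v gradient h f x) = frechet_derivative f (at x) v"
proof -
  have "h x *v gradient h f x = (\<chi> j. partial j f x)"
    using assms(1)
    by (simp add: gradient_def matrix_vector_mul_assoc matrix_inv_inverse)
  moreover have "frechet_derivative f (at x) v = (\<Sum>j\<in>UNIV. v $ j * partial j f x)"
  proof -
    interpret D: bounded_linear "frechet_derivative f (at x)"
      using assms(2) has_derivative_bounded_linear frechet_derivative_works by blast
    have "frechet_derivative f (at x) v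
        = frechet_derivative f (at x) (\<Sum>j\<in>UNIV. (v $ j) *\<^sub>R axis j 1)"
      by (simp add: basis_expansion scalar_mult_eq_scaleR [symmetric])
    also have "\<dots> = (\<Sum>j\<in>UNIV. v $ j * partial j f x)"
      by (simp add: D.sum D.scaleR partial_def)
    finally show ?thesis .
  qed
  ultimately show ?thesis
    by (simp add: inner_vec_def)
qed

lemma partial_metric_symmetric:
  assumes "\<forall>\<^sub>F y in nhds x. transpose (h y) = h y"
  shows "partial k (\<lambda>y. h y $ i $ j) x = partial k (\<lambda>y. h y $ j $ i) x"
proof -
  have "\<forall>\<^sub>F y in nhds x. h y $ i $ j = h y $ j $ i"
    using assms
  proof eventually_elim
    case (elim y)
    then have "transpose (h y) $ j $ i = h y $ j $ i" by simp
    then show ?case by (simp add: transpose_def)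
  qed
  then have ev: "\<forall>\<^sub>F y in at x. h y $ i $ j = h y $ j $ i"
      "\<forall>\<^sub>F y in at x. h y $ j $ i = h y $ i $ j"
    and eq: "h x $ i $ j = h x $ j $ i"
    by (auto simp: eventually_nhds_conv_at elim: eventually_mono)
  have "((\<lambda>y. h y $ i $ j) has_derivative D) (at x) = ((\<lambda>y. h y $ j $ i) has_derivative D) (at x)"
    for D
    using has_derivative_transform_eventually [OF _ ev(1) eq]
      has_derivative_transform_eventually [OF _ ev(2) eq [symmetric]] by auto
  then show ?thesis
    by (simp add: partial_def frechet_derivative_def)
qed

lemma christoffel_torsion_free:
  assumes "\<forall>\<^sub>F y in nhds x. transpose (h y) = h y"
  shows "christoffel h k i j x = christoffel h k j i x"
  unfolding christoffel_def
  by (simp add: partial_metric_symmetric [OF assms, of _ i j] add.commute)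

lemma christoffel_metric_compatible:
  assumes "invertible (h x)" "\<forall>\<^sub>F y in nhds x. transpose (h y) = h y"
  shows "partial k (\<lambda>y. h y $ i $ j) x =
    (\<Sum>l\<in>UNIV. christoffel h l k i x * h x $ l $ j) + (\<Sum>l\<in>UNIV. christoffel h l k j x * h x $ i $ l)"
proof -
  note sym = partial_metric_symmetric [OF assms(2)]
  have tr: "transpose (h x) = h x"
    using eventually_nhds_x_imp_x [OF assms(2)] .
  have hsym: "h x $ a $ b = h x $ b $ a" for a b
  proof -
    have "transpose (h x) $ b $ a = h x $ b $ a"
      by (simp only: tr)
    then show ?thesis by (simp add: transpose_def)
  qed
  define C where "C a b m =
    (1/2) * (partial a (\<lambda>y. h y $ b $ m) x + partial b (\<lambda>y. h y $ a $ m) x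
      - partial m (\<lambda>y. h y $ a $ b) x)" for a b m
  have lower: "(\<Sum>l\<in>UNIV. christoffel h l a b x * h x $ m $ l) = C a b m" for a b m
  proof -
    have "(\<Sum>l\<in>UNIV. christoffel h l a b x * h x $ m $ l)
        = (h x *v (matrix_inv (h x) *v (\<chi> n. C a b n))) $ m"
      by (simp add: christoffel_def C_def matrix_vector_mult_def sum_distrib_left sum_distrib_right
          mult_ac)
    also have "\<dots> = C a b m"
      using assms(1) by (simp add: matrix_vector_mul_assoc matrix_inv_inverse)
    finally show ?thesis .
  qed
  have "partial k (\<lambda>y. h y $ i $ j) x = C k i j + C k j i"
    using sym [of k i j] sym [of i k j] sym [of j k i] by (simp add: C_def field_simps)
  then show ?thesis
    using lower [of k i j] lower [of k j i] by (simp add: hsym [of _ j])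
qed


section \<open>The two equations\<close>

text \<open>These conditions do not depend on the chart; they are required in every chart of the atlas.\<close>

definition minimal_surface_eq ::
  "'a chart set \<Rightarrow> ('a chart \<Rightarrow> real^2 \<Rightarrow> real^2^2) \<Rightarrow> 'a set \<Rightarrow> ('a \<Rightarrow> real) \<Rightarrow> bool" where
  "minimal_surface_eq A g \<Omega> u \<longleftrightarrow>
     (\<forall>c\<in>A. \<forall>x\<in>chart_map c ` (chart_dom c \<inter> \<Omega>).
        let Du = gradient (g c) (u \<circ> chart_inv c) in
        divergence (g c) (\<lambda>y. Du y /\<^sub>R sqrt (1 + (metric_norm (g c) y (Du y))\<^sup>2)) x = 0)"

definition maximal_surface_eq ::
  "'a chart set \<Rightarrow> ('a chart \<Rightarrow> real^2 \<Rightarrow> real^2^2) \<Rightarrow> 'a set \<Rightarrow> ('a \<Rightarrow> real) \<Rightarrow> bool" where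
  "maximal_surface_eq A g \<Omega> w \<longleftrightarrow>
     (\<forall>c\<in>A. \<forall>x\<in>chart_map c ` (chart_dom c \<inter> \<Omega>).
        let Dw = gradient (g c) (w \<circ> chart_inv c) in
        divergence (g c) (\<lambda>y. Dw y /\<^sub>R sqrt (1 - (metric_norm (g c) y (Dw y))\<^sup>2)) x = 0 \<and>
        (metric_norm (g c) x (Dw x))\<^sup>2 < 1)"

definition parallel_gradient ::
  "'a chart set \<Rightarrow> ('a chart \<Rightarrow> real^2 \<Rightarrow> real^2^2) \<Rightarrow> 'a set \<Rightarrow> ('a \<Rightarrow> real) \<Rightarrow> bool" where
  "parallel_gradient A g \<Omega> u \<longleftrightarrow>
     (\<forall>c\<in>A. \<forall>x\<in>chart_map c ` (chart_dom c \<inter> \<Omega>). \<forall>i j.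
        cov_deriv (g c) (gradient (g c) (u \<circ> chart_inv c)) j i x = 0)"

end

theory Submission
  imports Defs
begin

text \<open>The two equations are the cases \<open>\<kappa> = 1\<close> and \<open>\<kappa> = -1\<close> of \<open>Div X = 0\<close> for
  \<open>X = Du / sqrt (1 + \<kappa>|Du|\<^sup>2)\<close>. Let \<open>J\<close> be the rotation by a right angle. The equation says that the
  1-form dual to \<open>JX\<close> is closed, so that on a simply connected domain \<open>JX = Dw\<close> for some \<open>w\<close>. Since
  \<open>1 - \<kappa>|Dw|\<^sup>2 = 1 / (1 + \<kappa>|Du|\<^sup>2)\<close>, the field \<open>Dw / sqrt (1 - \<kappa>|Dw|\<^sup>2)\<close> is \<open>J Du\<close>, which is divergence
  free; hence \<open>w\<close> solves the equation for \<open>-\<kappa>\<close>. If \<open>Dw\<close> is parallel, then \<open>|Dw|\<close> is locally constant,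
  and \<open>Du = - J Dw / sqrt (1 - \<kappa>|Dw|\<^sup>2)\<close> is parallel because \<open>J\<close> is.

  The atlas is not oriented, so \<open>J\<close> is given only up to sign on each chart. The orientation and the primitive
  \<open>w\<close> are constructed together, as a global section of a local system over \<open>\<Omega>\<close>.\<close>

section \<open>Sections of a local system over a simply connected space\<close>

text \<open>The algebra rests on one fact: \<open>X / sqrt (1 + \<kappa>|X|^2)\<close> and
  \<open>Y / sqrt (1 - \<kappa>|Y|^2)\<close> are mutually inverse maps of tangent vectors where the
  roots are positive, and both commute with the isometry \<open>J\<close>. So conjugation undoes
  itself up to sign, and one construction serves both implications. Closedness comes from the area
  form: the 1-form dual to \<open>JX\<close> is the contraction of the area form with
  \<open>X\<close>, and its exterior derivative is \<open>Div X\<close> times the area form. Since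
  the area form needs an orientation, this 1-form is twisted: under a change of charts it picks up
  the sign of the Jacobian determinant. The data at a point are therefore a sign and a value of the
  primitive, an element of {1, -1} x R. Near a point every such pair extends to a local solution,
  and two local solutions agree everywhere or nowhere on a small neighbourhood. This is a covering
  space of \<Omega>, and the monodromy theorem, proved below for abstract local sections, gives its
  global section. This is the only global step; the remaining claims are checked point by point in a
  chart.\<close>

lemma loops_homotopic:
  assumes "simply_connected S" "path p" "path_image p \<subseteq> S" "pathfinish p = pathstart p" "x \<in> S"
  shows "homotopic_loops S p (\<lambda>_. x)"
proof -
  have "path (\<lambda>_. x)" "path_image (\<lambda>_. x) \<subseteq> S" "pathfinish (\<lambda>_. x) = pathstart (\<lambda>_. x)"
    using assms(5) by (auto simp: path_def path_image_def pathstart_def pathfinish_def)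
  then show ?thesis
    using assms unfolding simply_connected_def by blast
qed

text \<open>An axiomatic covering space with fibre \<open>F\<close>: \<open>sec_exists\<close> says
  that small sets are evenly covered, and \<open>sec_agree\<close> is the source of unique
  continuation. The fibre is one fixed set without a topology; continuity is expressed only through
  membership in \<open>sec\<close>.\<close>

locale local_sections =
  fixes S :: "'a::topological_space set"
    and F :: "'v set"
    and sec :: "'a set \<Rightarrow> ('a \<Rightarrow> 'v) \<Rightarrow> bool"
  assumes sec_open: "sec U s \<Longrightarrow> openin (top_of_set S) U"
    and sec_values: "\<lbrakk>sec U s; x \<in> U\<rbrakk> \<Longrightarrow> s x \<in> F"
    and sec_exists: "x \<in> S \<Longrightarrow>
      \<exists>U. openin (top_of_set S) U \<and> x \<in> U \<and> path_connected U \<and>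
        (\<forall>y\<in>U. \<forall>v\<in>F. \<exists>s. sec U s \<and> s y = v)"
    and sec_agree: "\<lbrakk>sec U s; sec U' s'; x \<in> U; x \<in> U'\<rbrakk> \<Longrightarrow>
      \<exists>W. openin (top_of_set S) W \<and> x \<in> W \<and> ((\<forall>y\<in>W. s y = s' y) \<or> (\<forall>y\<in>W. s y \<noteq> s' y))"
begin

text \<open>A continuous lift of \<open>f\<close> into the covering space, phrased by local sections
  so that no topology on that space has to be built. The filter \<open>at z within Z\<close> omits
  \<open>z\<close> itself, hence the separate clause \<open>k z = s (f z)\<close>.\<close>

definition lifts :: "'z::topological_space set \<Rightarrow> ('z \<Rightarrow> 'a) \<Rightarrow> ('z \<Rightarrow> 'v) \<Rightarrow> bool" where
  "lifts Z f k \<longleftrightarrow> continuous_on Z f \<and> f ` Z \<subseteq> S \<and>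
    (\<forall>z\<in>Z. \<exists>U s. sec U s \<and> f z \<in> U \<and> k z = s (f z) \<and>
      (\<forall>\<^sub>F z' in at z within Z. k z' = s (f z')))"

lemma lifts_continuous: "lifts Z f k \<Longrightarrow> continuous_on Z f"
  and lifts_image: "lifts Z f k \<Longrightarrow> f ` Z \<subseteq> S"
  unfolding lifts_def by blast+

lemma lifts_local:
  assumes "lifts Z f k" "z \<in> Z"
  obtains U s where "sec U s" "f z \<in> U" "k z = s (f z)"
    "\<forall>\<^sub>F z' in at z within Z. k z' = s (f z')"
  using assms unfolding lifts_def by blast

lemma eventually_in_openin:
  assumes "continuous_on Z f" "f ` Z \<subseteq> S" "openin (top_of_set S) W" "z \<in> Z" "f z \<in> W"
  shows "\<forall>\<^sub>F z' in at z within Z. f z' \<in> W"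
proof -
  obtain O' where O': "open O'" "W = S \<inter> O'"
    using assms(3) by (auto simp: openin_open)
  have "(f \<longlongrightarrow> f z) (at z within Z)"
    using assms(1,4) by (simp add: continuous_on_def)
  then have "\<forall>\<^sub>F z' in at z within Z. f z' \<in> O'"
    using O' assms(5) topological_tendstoD by blast
  moreover have "\<forall>\<^sub>F z' in at z within Z. z' \<in> Z"
    by (simp add: eventually_at_filter)
  ultimately show ?thesis
    by eventually_elim (use O' assms(2) in auto)
qed

text \<open>By \<open>sec_agree\<close> the truth value of \<open>k z = k' z\<close> is locally
  constant, hence constant on a connected set.\<close>

lemma lifts_unique:
  assumes k: "lifts Z f k" and k': "lifts Z f k'" and "connected Z" "a \<in> Z" "b \<in> Z" "k a = k' a"
  shows "k b = k' b"
proof -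
  have "\<forall>z\<in>Z. \<forall>\<^sub>F z' in at z within Z. (k z = k' z) = (k z' = k' z')"
  proof
    fix z assume z: "z \<in> Z"
    obtain U s where s: "sec U s" "f z \<in> U" "k z = s (f z)"
      "\<forall>\<^sub>F z' in at z within Z. k z' = s (f z')"
      using lifts_local [OF k z] by blast
    obtain U' s' where s': "sec U' s'" "f z \<in> U'" "k' z = s' (f z)"
      "\<forall>\<^sub>F z' in at z within Z. k' z' = s' (f z')"
      using lifts_local [OF k' z] by blast
    obtain W where W: "openin (top_of_set S) W" "f z \<in> W"
      "(\<forall>y\<in>W. s y = s' y) \<or> (\<forall>y\<in>W. s y \<noteq> s' y)"
      using sec_agree [OF s(1) s'(1) s(2) s'(2)] by blast
    have "\<forall>\<^sub>F z' in at z within Z. f z' \<in> W"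
      by (rule eventually_in_openin [OF lifts_continuous [OF k] lifts_image [OF k] W(1) z W(2)])
    then show "\<forall>\<^sub>F z' in at z within Z. (k z = k' z) = (k z' = k' z')"
      using s(4) s'(4) by eventually_elim (use W(2,3) s(3) s'(3) in auto)
  qed
  then show ?thesis
    using connected_local_const [OF assms(3-5), of "\<lambda>z. k z = k' z"] assms(6) by simp
qed

lemma lifts_sec:
  assumes "sec U s" "continuous_on Z f" "f ` Z \<subseteq> U"
  shows "lifts Z f (\<lambda>z. s (f z))"
  unfolding lifts_def using assms openin_imp_subset [OF sec_open [OF assms(1)]]
  by (intro conjI ballI exI [of _ U] exI [of _ s]) auto

lemma lifts_compose:
  assumes k: "lifts Z f k" and g: "continuous_on Z' g" "g ` Z' \<subseteq> Z"
  shows "lifts Z' (\<lambda>z. f (g z)) (\<lambda>z. k (g z))"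
  unfolding lifts_def
proof (intro conjI ballI)
  show "continuous_on Z' (\<lambda>z. f (g z))"
    by (rule continuous_on_compose2 [OF lifts_continuous [OF k] g])
  show "(\<lambda>z. f (g z)) ` Z' \<subseteq> S"
    using lifts_image [OF k] g by auto
  fix z assume z: "z \<in> Z'"
  then obtain U s where s: "sec U s" "f (g z) \<in> U" "k (g z) = s (f (g z))"
      "\<forall>\<^sub>F y in at (g z) within Z. k y = s (f y)"
    using lifts_local [OF k, of "g z"] g by blast
  \<comment> \<open>The value at \<open>g z\<close> itself is included by \<open>s(3)\<close>,
    because \<open>g\<close> may take the value \<open>g z\<close> at points other than
    \<open>z\<close>.\<close>
  obtain N where N: "open N" "g z \<in> N" "\<forall>y\<in>N. y \<in> Z \<longrightarrow> k y = s (f y)"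
    using s(3,4) unfolding eventually_at_topological by metis
  have "(g \<longlongrightarrow> g z) (at z within Z')"
    using g z by (simp add: continuous_on_def)
  then have "\<forall>\<^sub>F y in at z within Z'. g y \<in> N"
    using N topological_tendstoD by blast
  moreover have "\<forall>\<^sub>F y in at z within Z'. y \<in> Z'"
    by (simp add: eventually_at_filter)
  ultimately have "\<forall>\<^sub>F y in at z within Z'. k (g y) = s (f (g y))"
    by eventually_elim (use N g in auto)
  then show "\<exists>U s. sec U s \<and> f (g z) \<in> U \<and> k (g z) = s (f (g z)) \<and>
      (\<forall>\<^sub>F y in at z within Z'. k (g y) = s (f (g y)))"
    using s by blast
qed

lemma lifts_cong:
  assumes "lifts Z f k" "\<And>z. z \<in> Z \<Longrightarrow> f z = f' z" "\<And>z. z \<in> Z \<Longrightarrow> k z = k' z"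
  shows "lifts Z f' k'"
  unfolding lifts_def
proof (intro conjI ballI)
  show "continuous_on Z f'"
    using lifts_continuous [OF assms(1)] assms(2) continuous_on_cong [of Z Z f f'] by auto
  show "f' ` Z \<subseteq> S"
    using lifts_image [OF assms(1)] assms(2) by force
  fix z assume z: "z \<in> Z"
  then obtain U s where s: "sec U s" "f z \<in> U" "k z = s (f z)"
      "\<forall>\<^sub>F y in at z within Z. k y = s (f y)"
    using lifts_local [OF assms(1)] by blast
  have "\<forall>\<^sub>F y in at z within Z. y \<in> Z"
    by (simp add: eventually_at_filter)
  with s(4) have "\<forall>\<^sub>F y in at z within Z. k' y = s (f' y)"
    by eventually_elim (use assms in auto)
  then show "\<exists>U s. sec U s \<and> f' z \<in> U \<and> k' z = s (f' z) \<and>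
      (\<forall>\<^sub>F y in at z within Z. k' y = s (f' y))"
    using s assms(2,3) [OF z] by (intro exI [of _ U] exI [of _ s]) auto
qed

text \<open>Only the common endpoint \<open>b\<close> is at issue. The sections that describe
  \<open>k\<close> on its two sides have the same value at \<open>f b\<close>, so by
  \<open>sec_agree\<close> the left one may replace the right one.\<close>

lemma lifts_join:
  fixes a b c :: real
  assumes 1: "lifts {a..b} f k" and 2: "lifts {b..c} f k" and le: "a \<le> b" "b \<le> c"
  shows "lifts {a..c} f k"
  unfolding lifts_def
proof (intro conjI ballI)
  have ac: "{a..c} = {a..b} \<union> {b..c}"
    using le by auto
  show "continuous_on {a..c} f"
    unfolding ac using lifts_continuous 1 2 by (intro continuous_on_closed_Un) auto
  show "f ` {a..c} \<subseteq> S"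
    unfolding ac using lifts_image [OF 1] lifts_image [OF 2] by auto
  note cont = \<open>continuous_on {a..c} f\<close> \<open>f ` {a..c} \<subseteq> S\<close>
  fix z assume z: "z \<in> {a..c}"
  have split: "\<forall>\<^sub>F y in at z within {a..c}. P y"
    if "\<forall>\<^sub>F y in at z within {a..b}. P y" "\<forall>\<^sub>F y in at z within {b..c}. P y" for P
    using that unfolding ac by (simp add: at_within_union eventually_sup)
  \<comment> \<open>Away from a closed interval the filter within it is trivial, so that interval
    imposes no condition.\<close>
  have triv: "\<forall>\<^sub>F y in at z within C. P y" if "closed C" "z \<notin> C" for C P
  proof -
    have "\<not> z islimpt C" using that closed_limpt by blast
    then have "at z within C = bot" by (simp add: trivial_limit_within)
    then show ?thesis by simp
  qed
  consider "z \<in> {a..b}" "z \<in> {b..c}" | "z \<in> {a..b}" "z \<notin> {b..c}" | "z \<notin> {a..b}" "z \<in> {b..c}"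
    using z by fastforce
  then show "\<exists>U s. sec U s \<and> f z \<in> U \<and> k z = s (f z) \<and>
      (\<forall>\<^sub>F y in at z within {a..c}. k y = s (f y))"
  proof cases
    case both: 1
    obtain U s where s: "sec U s" "f z \<in> U" "k z = s (f z)"
        "\<forall>\<^sub>F y in at z within {a..b}. k y = s (f y)"
      using lifts_local [OF 1 both(1)] by blast
    obtain U' s' where s': "sec U' s'" "f z \<in> U'" "k z = s' (f z)"
        "\<forall>\<^sub>F y in at z within {b..c}. k y = s' (f y)"
      using lifts_local [OF 2 both(2)] by blast
    obtain W where W: "openin (top_of_set S) W" "f z \<in> W" "\<forall>y\<in>W. s y = s' y"
      using sec_agree [OF s(1) s'(1) s(2) s'(2)] s(3) s'(3) by metis
    have "\<forall>\<^sub>F y in at z within {b..c}. f y \<in> W"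
      by (rule eventually_in_openin [OF lifts_continuous [OF 2] lifts_image [OF 2] W(1) both(2) W(2)])
    with s'(4) have "\<forall>\<^sub>F y in at z within {b..c}. k y = s (f y)"
      by eventually_elim (use W in auto)
    then show ?thesis
      using s split by blast
  next
    case 2
    then show ?thesis
      using lifts_local [OF 1] triv [of "{b..c}"] split by (metis closed_atLeastAtMost)
  next
    case 3
    then show ?thesis
      using lifts_local [OF 2] triv [of "{a..b}"] split by (metis closed_atLeastAtMost)
  qed
qed

section \<open>Path lifting, homotopy lifting and monodromy\<close>

lemma lifts_values: "lifts Z f k \<Longrightarrow> z \<in> Z \<Longrightarrow> k z \<in> F"
  using lifts_local sec_values by metis

lemma path_lift:
  fixes f :: "real \<Rightarrow> 'a"
  assumes "continuous_on {a..b} f" "f ` {a..b} \<subseteq> S" "a \<le> b" "v \<in> F"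
  shows "\<exists>k. lifts {a..b} f k \<and> k a = v"
proof -
  \<comment> \<open>Transport of every starting value is stable under concatenation and possible on
    short intervals, so bisection applies. The guard \<open>{x..y} \<subseteq> {a..b}\<close> is
    there because the rule \<open>Bolzano\<close> also asks about short intervals that stick out of
    \<open>{a..b}\<close>.\<close>
  define P where "P x y \<longleftrightarrow> ({x..y} \<subseteq> {a..b} \<and> x \<le> y \<longrightarrow> (\<forall>v\<in>F. \<exists>k. lifts {x..y} f k \<and> k x = v))" for x y
  have "P a b"
    using \<open>a \<le> b\<close>
  proof (induction rule: Bolzano)
    case (trans x y z)
    show ?case
      unfolding P_def
    proof (intro impI ballI)
      fix v assume sub: "{x..z} \<subseteq> {a..b} \<and> x \<le> z" and v: "v \<in> F"
      then have "{x..y} \<subseteq> {a..b}" "{y..z} \<subseteq> {a..b}"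
        using trans by auto
      then obtain k where k: "lifts {x..y} f k" "k x = v"
        using trans v unfolding P_def by blast
      then have "k y \<in> F"
        using lifts_values trans by force
      then obtain k' where k': "lifts {y..z} f k'" "k' y = k y"
        using trans \<open>{y..z} \<subseteq> {a..b}\<close> unfolding P_def by blast
      define m where "m t = (if t \<le> y then k t else k' t)" for t
      have "lifts {x..y} f m" "lifts {y..z} f m"
        by (rule lifts_cong [OF k(1)], auto simp: m_def)
          (rule lifts_cong [OF k'(1)], auto simp: m_def k')
      then have "lifts {x..z} f m"
        using trans lifts_join by blast
      moreover have "m x = v"
        using trans k by (simp add: m_def)
      ultimately show "\<exists>k. lifts {x..z} f k \<and> k x = v"
        by blast
    qed
  next
    case (local x)
    then have "f x \<in> S" using assms by auto
    then obtain U where U: "openin (top_of_set S) U" "f x \<in> U" "\<forall>y\<in>U. \<forall>v\<in>F. \<exists>s. sec U s \<and> s y = v"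
      using sec_exists by meson
    have "\<forall>\<^sub>F y in at x within {a..b}. f y \<in> U"
      using assms U local by (intro eventually_in_openin) auto
    then obtain d where d: "d > 0" "\<And>y. y \<in> {a..b} \<Longrightarrow> dist y x < d \<Longrightarrow> f y \<in> U"
      using U(2) unfolding eventually_at by metis
    show ?case
    proof (intro exI [of _ d] conjI allI impI d(1))
      fix y z assume yz: "y \<le> x \<and> x \<le> z \<and> z - y < d"
      show "P y z"
        unfolding P_def
      proof (intro impI ballI)
        fix v assume sub: "{y..z} \<subseteq> {a..b} \<and> y \<le> z" and v: "v \<in> F"
        have im: "f ` {y..z} \<subseteq> U"
        proof
          fix p assume "p \<in> f ` {y..z}"
          then obtain t where "t \<in> {y..z}" "p = f t" by auto
          then show "p \<in> U" using d(2) [of t] sub yz by (auto simp: dist_real_def)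
        qed
        then obtain s where s: "sec U s" "s (f y) = v"
          using U(3) v sub by (metis atLeastAtMost_iff image_subset_iff order_refl)
        have "lifts {y..z} f (\<lambda>t. s (f t))"
          using s im sub assms by (intro lifts_sec) (auto intro: continuous_on_subset)
        then show "\<exists>k. lifts {y..z} f k \<and> k y = v"
          using s by blast
      qed
    qed
  qed
  then show ?thesis
    using assms unfolding P_def by blast
qed

text \<open>For fixed \<open>s\<close>, the property that a single section describes
  \<open>K s' t\<close> for all \<open>s'\<close> near \<open>s\<close> travels from
  \<open>t = 0\<close> to \<open>t = 1\<close> in small steps. On a small square that
  \<open>h\<close> maps into an evenly covered set \<open>U\<close>, a section over \<open>U\<close>
  that matches on one edge matches on the opposite edge, by uniqueness of lifts along each
  slice.\<close>

lemma lifts_homotopy: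
  fixes h :: "real \<times> real \<Rightarrow> 'a"
  assumes h: "continuous_on ({0..1} \<times> {0..1}) h" "h ` ({0..1} \<times> {0..1}) \<subseteq> S"
    and K: "\<And>s. s \<in> {0..1} \<Longrightarrow> lifts {0..1} (\<lambda>t. h (s, t)) (K s)"
    and K0: "lifts {0..1} (\<lambda>s. h (s, 0)) (\<lambda>s. K s 0)"
  shows "lifts {0..1} (\<lambda>s. h (s, 1)) (\<lambda>s. K s 1)"
proof -
  define I where "I = {0..1::real}"
  have slice: "continuous_on I (\<lambda>s. h (s, t))" "(\<lambda>s. h (s, t)) ` I \<subseteq> S" if "t \<in> I" for t
    using that h by (auto simp: I_def intro!: continuous_on_compose2 [OF h(1)] continuous_intros)
  have "\<exists>U \<sigma>. sec U \<sigma> \<and> h (s, 1) \<in> U \<and> K s 1 = \<sigma> (h (s, 1)) \<and>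
      (\<forall>\<^sub>F s' in at s within I. K s' 1 = \<sigma> (h (s', 1)))" if s: "s \<in> I" for s
  proof -
    define Q where "Q t \<longleftrightarrow> (\<exists>U \<sigma>. sec U \<sigma> \<and> h (s, t) \<in> U \<and> K s t = \<sigma> (h (s, t)) \<and>
      (\<forall>\<^sub>F s' in at s within I. K s' t = \<sigma> (h (s', t))))" for t
    \<comment> \<open>An implication is bisected, so that concatenation of intervals is transitivity
      of implication.\<close>
    have "{0..1} \<subseteq> I \<and> Q 0 \<longrightarrow> Q 1"
      using zero_le_one
    proof (induction rule: Bolzano [where P = "\<lambda>a b. {a..b} \<subseteq> I \<and> Q a \<longrightarrow> Q b"])
      case (trans a b c)
      then have "{a..b} \<subseteq> {a..c}" "{b..c} \<subseteq> {a..c}"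
        by simp_all
      then show ?case using trans by blast
    next
      case (local t)
      then have "h (s, t) \<in> S" "(s, t) \<in> I \<times> I"
        using h s by (auto simp: I_def)
      then obtain U where U: "openin (top_of_set S) U" "h (s, t) \<in> U"
          "\<forall>y\<in>U. \<forall>v\<in>F. \<exists>s. sec U s \<and> s y = v"
        using sec_exists by meson
      have "\<forall>\<^sub>F z in at (s, t) within I \<times> I. h z \<in> U"
        using h U \<open>(s, t) \<in> I \<times> I\<close> by (intro eventually_in_openin) (auto simp: I_def)
      then obtain e where e: "e > 0" "\<And>z. z \<in> I \<times> I \<Longrightarrow> dist z (s, t) < e \<Longrightarrow> h z \<in> U"
        using U(2) unfolding eventually_at by metis
      \<comment> \<open>With the bound \<open>e / 2\<close> for each coordinate, the sum of the two
        differences, which bounds the distance, stays below \<open>e\<close>.\<close>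
      have U': "h (s', t') \<in> U" if "s' \<in> I" "t' \<in> I" "\<bar>s' - s\<bar> < e / 2" "\<bar>t' - t\<bar> < e / 2" for s' t'
      proof (rule e(2))
        have "dist (s', t') (s, t) \<le> \<bar>s' - s\<bar> + \<bar>t' - t\<bar>"
          unfolding dist_Pair_Pair dist_real_def using sqrt_sum_squares_le_sum_abs by force
        then show "dist (s', t') (s, t) < e" using that by linarith
      qed (use that in auto)
      show ?case
      proof (intro exI [of _ "e / 2"] conjI allI impI)
        show "0 < e / 2" using e by simp
        fix a b assume ab: "a \<le> t \<and> t \<le> b \<and> b - a < e / 2" and "{a..b} \<subseteq> I \<and> Q a"
        then have sub: "{a..b} \<subseteq> I" "a \<in> I" "b \<in> I" and "Q a"
          by auto
        then obtain U1 \<sigma>1 where 1: "sec U1 \<sigma>1" "h (s, a) \<in> U1" "K s a = \<sigma>1 (h (s, a))"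
            "\<forall>\<^sub>F s' in at s within I. K s' a = \<sigma>1 (h (s', a))"
          unfolding Q_def by blast
        have hU: "h (s', t') \<in> U" if "s' \<in> I" "\<bar>s' - s\<bar> < e / 2" "t' \<in> {a..b}" for s' t'
        proof (rule U')
          show "\<bar>t' - t\<bar> < e / 2" using that(3) ab unfolding abs_less_iff atLeastAtMost_iff by linarith
        qed (use that sub in auto)
        have hsa: "h (s, a) \<in> U"
          using hU [of s a] s e ab by auto
        moreover have "K s a \<in> F"
          using 1 sec_values by metis
        ultimately obtain \<sigma> where \<sigma>: "sec U \<sigma>" "\<sigma> (h (s, a)) = K s a"
          using U(3) by blast
        \<comment> \<open>\<open>Q a\<close> speaks of some section \<open>\<sigma>1\<close> with an
          unknown domain; on \<open>W\<close> it may be replaced by \<open>\<sigma>\<close>, which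
          is defined on all of \<open>U\<close> and so reaches \<open>h (s, b)\<close>.\<close>
        obtain W where W: "openin (top_of_set S) W" "h (s, a) \<in> W" "\<forall>y\<in>W. \<sigma> y = \<sigma>1 y"
          using sec_agree [OF \<sigma>(1) 1(1) hsa 1(2)] \<sigma>(2) 1(3) by metis
        have evW: "\<forall>\<^sub>F s' in at s within I. h (s', a) \<in> W"
          using slice [OF \<open>a \<in> I\<close>] W s by (intro eventually_in_openin) auto
        have near: "K s' b = \<sigma> (h (s', b))"
          if s': "s' \<in> I" "\<bar>s' - s\<bar> < e / 2" "K s' a = \<sigma> (h (s', a))" for s'
        proof -
          have "lifts {a..b} (\<lambda>t. h (s', t)) (K s')"
            using lifts_compose [OF K, of s' "{a..b}" "\<lambda>x. x"] s' sub(1) by (simp add: I_def)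
          moreover have "lifts {a..b} (\<lambda>t. h (s', t)) (\<lambda>t. \<sigma> (h (s', t)))"
            using s' hU sub \<open>{a..b} \<subseteq> I\<close>
            by (intro lifts_sec [OF \<sigma>(1)] continuous_on_compose2 [OF h(1)] continuous_intros)
              (auto simp: I_def)
          ultimately show ?thesis
            by (rule lifts_unique [of _ _ _ _ a]) (use ab s' in auto)
        qed
        have "\<forall>\<^sub>F s' in at s within I. s' \<in> I \<and> \<bar>s' - s\<bar> < e / 2"
          unfolding eventually_at using e by (intro exI [of _ "e / 2"]) (auto simp: dist_real_def)
        with evW 1(4) have "\<forall>\<^sub>F s' in at s within I. K s' b = \<sigma> (h (s', b))"
          by eventually_elim (use W near in auto)
        moreover have "K s b = \<sigma> (h (s, b))"
          using near [of s] s e \<sigma> by auto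
        moreover have "h (s, b) \<in> U"
          using hU [of s b] s e ab by auto
        ultimately show "Q b"
          unfolding Q_def using \<sigma> by blast
      qed
    qed
    moreover have "Q 0"
      using lifts_local [OF K0, of s] s unfolding Q_def I_def by blast
    ultimately show ?thesis
      unfolding Q_def I_def by blast
  qed
  then show ?thesis
    unfolding lifts_def I_def [symmetric] using slice [of 1] by (simp add: I_def)
qed

text \<open>While the loop shrinks, its base point traces the curve \<open>s -> h (s, 0)\<close>.
  The initial and the terminal values of transport around the loop with parameter \<open>s\<close>
  are both lifts of this curve. They agree at \<open>s = 1\<close>, where the loop is constant,
  hence also at \<open>s = 0\<close>, where the loop is \<open>p\<close>.\<close>

lemma lifts_contractible_loop:
  fixes p :: "real \<Rightarrow> 'a"
  assumes "homotopic_loops S p (\<lambda>_. x)" "lifts {0..1} p k"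
  shows "k 0 = k 1"
proof -
  obtain h where h: "continuous_on ({0..1} \<times> {0..1}) h" "h ` ({0..1} \<times> {0..1}) \<subseteq> S"
      and h0: "\<And>t. t \<in> {0..1} \<Longrightarrow> h (0, t) = p t" and h1: "\<And>t. t \<in> {0..1} \<Longrightarrow> h (1, t) = x"
      and loop: "\<And>s. s \<in> {0..1::real} \<Longrightarrow> h (s, 1::real) = h (s, 0)"
    using assms(1) by (auto simp: homotopic_loops pathstart_def pathfinish_def image_subset_iff_funcset)
  have "k 0 \<in> F"
    using lifts_values [OF assms(2)] by simp
  moreover have "continuous_on {0..1} (\<lambda>s. h (s, 0))" "(\<lambda>s. h (s, 0)) ` {0..1} \<subseteq> S"
    using h(2) by (auto intro!: continuous_on_compose2 [OF h(1)] continuous_intros)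
  ultimately obtain k0 where k0: "lifts {0..1} (\<lambda>s. h (s, 0)) k0" "k0 0 = k 0"
    using path_lift by (metis zero_le_one)
  have "\<exists>k'. lifts {0..1} (\<lambda>t. h (s, t)) k' \<and> k' 0 = k0 s" if "s \<in> {0..1}" for s
    using that h(2) lifts_values [OF k0(1)]
    by (intro path_lift) (auto intro!: continuous_on_compose2 [OF h(1)] continuous_intros)
  then obtain K where K: "\<And>s. s \<in> {0..1} \<Longrightarrow> lifts {0..1} (\<lambda>t. h (s, t)) (K s)"
      "\<And>s. s \<in> {0..1} \<Longrightarrow> K s 0 = k0 s"
    by metis
  have K0: "lifts {0..1} (\<lambda>s. h (s, 0)) (\<lambda>s. K s 0)"
    by (rule lifts_cong [OF k0(1)]) (use K(2) in auto)
  have "lifts {0..1} (\<lambda>s. h (s, 1)) (\<lambda>s. K s 1)"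
    by (rule lifts_homotopy [OF h K(1) K0])
  then have K1: "lifts {0..1} (\<lambda>s. h (s, 0)) (\<lambda>s. K s 1)"
    by (rule lifts_cong) (use loop in auto)
  have const: "lifts {0..1} (\<lambda>t. x) (K 1)"
    by (rule lifts_cong [OF K(1) [of 1]]) (use h1 in auto)
  have const': "lifts {0..1::real} (\<lambda>t. x) (\<lambda>_. K 1 0)"
    by (rule lifts_compose [OF const, of "{0..1}" "\<lambda>_. 0"]) auto
  have "K 1 0 = K 1 1"
    using lifts_unique [OF const' const, of 0 1] by simp
  then have "K 0 0 = K 0 1"
    using lifts_unique [OF K0 K1, of 1 0] by simp
  moreover have "lifts {0..1} p (K 0)"
    by (rule lifts_cong [OF K(1) [of 0]]) (use h0 in auto)
  ultimately show ?thesis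
    using lifts_unique [OF assms(2), of "K 0" 0] K(2) [of 0] k0 by (metis atLeastAtMost_iff connected_Icc order_refl zero_le_one)
qed

lemma lifts_joinpaths:
  assumes p: "lifts {0..1} p k" and q: "lifts {0..1} q k'"
    and "pathfinish p = pathstart q" "k 1 = k' 0"
  obtains m where "lifts {0..1} (p +++ q) m" "m 0 = k 0" "m 1 = k' 1"
proof
  define m where "m t = (if t \<le> 1/2 then k (2 * t) else k' (2 * t - 1))" for t :: real
  show "m 0 = k 0" "m 1 = k' 1"
    by (simp_all add: m_def)
  show "lifts {0..1} (p +++ q) m"
  proof (rule lifts_join)
    have "lifts {0..1/2} (\<lambda>t. p (2 * t)) (\<lambda>t. k (2 * t))"
      by (intro lifts_compose [OF p] continuous_intros) auto
    then show "lifts {0..1/2} (p +++ q) m"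
      by (rule lifts_cong) (auto simp: joinpaths_def m_def)
    have "lifts {1/2..1} (\<lambda>t. q (2 * t - 1)) (\<lambda>t. k' (2 * t - 1))"
      by (intro lifts_compose [OF q] continuous_intros) auto
    then show "lifts {1/2..1} (p +++ q) m"
    proof (rule lifts_cong)
      fix t :: real assume "t \<in> {1/2..1}"
      \<comment> \<open>At the midpoint \<open>joinpaths\<close> and \<open>m\<close> use their
        first branch, so the two matching conditions are needed exactly there.\<close>
      then consider "2 * t = 1" | "\<not> t \<le> 1/2" by fastforce
      then show "q (2 * t - 1) = (p +++ q) t" "k' (2 * t - 1) = m t"
        using assms(3,4)
        by (cases, simp_all add: joinpaths_def m_def pathstart_def pathfinish_def)+
    qed
  qed auto
qed

text \<open>Transport along \<open>p\<close> and then backwards along \<open>q\<close> goes around a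
  contractible loop and so returns to its initial value. Its backward half \<open>m\<close> and the
  reversed lift \<open>k'\<close> then agree at their end, hence at their start.\<close>

lemma lifts_endpoint_unique:
  fixes p q :: "real \<Rightarrow> 'a"
  assumes "simply_connected S"
    and p: "lifts {0..1} p k" and q: "lifts {0..1} q k'"
    and "p 0 = q 0" "p 1 = q 1" "k 0 = k' 0"
  shows "k 1 = k' 1"
proof -
  have r: "lifts {0..1} (\<lambda>t. q (1 - t)) (\<lambda>t. k' (1 - t))"
    by (intro lifts_compose [OF q] continuous_intros) auto
  obtain m where m: "lifts {0..1} (\<lambda>t. q (1 - t)) m" "m 0 = k 1"
    using path_lift [OF lifts_continuous [OF r] lifts_image [OF r] _ lifts_values [OF p, of 1]] by auto
  let ?l = "p +++ (\<lambda>t. q (1 - t))"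
  obtain n where l: "lifts {0..1} ?l n" "n 0 = k 0" "n 1 = m 1"
    using lifts_joinpaths [OF p m(1)] m(2) assms(5) by (auto simp: pathstart_def pathfinish_def)
  have "homotopic_loops S ?l (\<lambda>_. p 0)"
  proof (rule loops_homotopic [OF assms(1)])
    show "path ?l" "path_image ?l \<subseteq> S"
      using lifts_continuous [OF l(1)] lifts_image [OF l(1)] by (simp_all add: path_def path_image_def)
    show "pathfinish ?l = pathstart ?l"
      using assms(4) by (simp add: pathstart_def pathfinish_def joinpaths_def)
    show "p 0 \<in> S"
      using lifts_image [OF p] by auto
  qed
  then have "n 0 = n 1"
    using lifts_contractible_loop l by blast
  then have "m 1 = k' 0"
    using assms(6) l by simp
  moreover have "m 0 = k' (1 - 0)"
    using lifts_unique [OF m(1) r, of 1 0] \<open>m 1 = k' 0\<close> by simp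
  ultimately show ?thesis
    using m(2) by simp
qed

text \<open>A value at a base point is transported along paths, and
  \<open>lifts_endpoint_unique\<close> makes the result independent of the path.\<close>

lemma global_section:
  assumes sc: "simply_connected S" and "F \<noteq> {}"
  obtains G where "\<And>x. x \<in> S \<Longrightarrow> \<exists>U s. sec U s \<and> x \<in> U \<and> (\<forall>y\<in>U. G y = s y)"
proof (cases "S = {}")
  case True
  then show ?thesis using that by blast
next
  case False
  then obtain x0 v0 where x0: "x0 \<in> S" and v0: "v0 \<in> F"
    using assms(2) by blast
  define R where "R x v \<longleftrightarrow> (\<exists>p k. lifts {0..1::real} p k \<and> p 0 = x0 \<and> p 1 = x \<and> k 0 = v0 \<and> k 1 = v)" for x v
  have Rex: "\<exists>v. R x v" if "x \<in> S" for x
  proof -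
    \<comment> \<open>Simple connectedness makes any two loops freely homotopic. For the constant
      loops at \<open>x0\<close> and \<open>x\<close>, the track of the base point is a path that
      joins them.\<close>
    have "homotopic_loops S (\<lambda>_. x0) (\<lambda>_. x)"
      by (rule loops_homotopic [OF sc])
        (use x0 that in \<open>auto simp: path_def path_image_def pathstart_def pathfinish_def\<close>)
    then obtain h where h: "continuous_on ({0..1::real} \<times> {0..1::real}) h" "h ` ({0..1} \<times> {0..1}) \<subseteq> S"
        "h (0, 0) = x0" "h (1, 0) = x"
      by (auto simp: homotopic_loops image_subset_iff_funcset)
    have "continuous_on {0..1} (\<lambda>s. h (s, 0))" "(\<lambda>s. h (s, 0)) ` {0..1} \<subseteq> S"
      using h(2) by (auto intro!: continuous_on_compose2 [OF h(1)] continuous_intros)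
    then obtain k where "lifts {0..1} (\<lambda>s. h (s, 0)) k" "k 0 = v0"
      using path_lift v0 by (metis zero_le_one)
    then show ?thesis
      unfolding R_def using h by (intro exI [of _ "k 1"] exI [of _ "\<lambda>s. h (s, 0)"] exI [of _ k]) auto
  qed
  have Runique: "v = v'" if "R x v" "R x v'" for x v v'
    using that lifts_endpoint_unique [OF sc] unfolding R_def by metis
  define G where "G x = (THE v. R x v)" for x
  have G: "R x v \<Longrightarrow> G x = v" for x v
    unfolding G_def using Runique by blast
  show ?thesis
  proof (rule that)
    fix x assume x: "x \<in> S"
    obtain U where U: "x \<in> U" "path_connected U" "\<forall>y\<in>U. \<forall>v\<in>F. \<exists>s. sec U s \<and> s y = v"
      using sec_exists [OF x] by blast
    obtain p k where p: "lifts {0..1::real} p k" "p 0 = x0" "p 1 = x" "k 0 = v0"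
      using Rex [OF x] unfolding R_def by blast
    have "k 1 \<in> F"
      using lifts_values [OF p(1)] by simp
    then obtain s where s: "sec U s" "s x = k 1"
      using U(1,3) by meson
    \<comment> \<open>The point \<open>y\<close> is reached by the fixed path to \<open>x\<close>
      followed by a path inside \<open>U\<close>, along which \<open>s\<close> itself is the
      transport.\<close>
    have "G y = s y" if y: "y \<in> U" for y
    proof -
      obtain q where q: "path q" "path_image q \<subseteq> U" "pathstart q = x" "pathfinish q = y"
        using U(1) y path_connected_def [THEN iffD1, OF U(2)] by meson
      have "lifts {0..1} q (\<lambda>t. s (q t))"
        using q by (intro lifts_sec [OF s(1)]) (auto simp: path_def path_image_def)
      then obtain n where "lifts {0..1} (p +++ q) n" "n 0 = k 0" "n 1 = s (q 1)"
        using p(3) q(3) s(2)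
        by (elim lifts_joinpaths [OF p(1), of q "\<lambda>t. s (q t)"]) (auto simp: pathfinish_def pathstart_def)
      then have "R y (s y)"
        unfolding R_def using p q
        by (intro exI [of _ "p +++ q"] exI [of _ n]) (auto simp: joinpaths_def pathfinish_def)
      then show ?thesis by (rule G)
    qed
    then show "\<exists>U s. sec U s \<and> x \<in> U \<and> (\<forall>y\<in>U. G y = s y)"
      using s U by blast
  qed
qed

end

section \<open>Calculus of smooth functions\<close>

lemma Ck_on_cong:
  assumes "open S" "\<And>x. x \<in> S \<Longrightarrow> f x = g x" "Ck_on k S f"
  shows "Ck_on k S g"
  using assms(2,3)
proof (induction k arbitrary: f g)
  case 0
  then show ?case using continuous_on_cong [of S S f g] by simp
next
  case (Suc k)
  have d: "(g has_derivative frechet_derivative f (at x)) (at x)" if "x \<in> S" for x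
    using Suc.prems that assms(1) frechet_derivative_works [of f "at x"]
    by (intro has_derivative_transform_within_open [of f _ x UNIV S g]) auto
  then have g: "g differentiable at x" "frechet_derivative g (at x) = frechet_derivative f (at x)"
    if "x \<in> S" for x
    using d [OF that] frechet_derivative_at [OF d [OF that]] by (auto simp: differentiable_def)
  moreover have "Ck_on k S (\<lambda>x. frechet_derivative g (at x) v)" for v
    by (rule Suc.IH [of "\<lambda>x. frechet_derivative f (at x) v"]) (use g Suc.prems(2) in auto)
  ultimately show ?case
    by simp
qed

text \<open>Replaces the chosen \<open>frechet_derivative\<close> by an explicit derivative
  \<open>D\<close>; the product, reciprocal and root rules enter through it.\<close>

lemma Ck_on_SucI:
  assumes "open S" "\<And>x. x \<in> S \<Longrightarrow> (f has_derivative D x) (at x)" "\<And>v. Ck_on k S (\<lambda>x. D x v)"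
  shows "Ck_on (Suc k) S f"
proof -
  have "frechet_derivative f (at x) = D x" if "x \<in> S" for x
    using assms(2) [OF that] frechet_derivative_at by metis
  then have "Ck_on k S (\<lambda>x. frechet_derivative f (at x) v)" for v
    by (intro Ck_on_cong [OF assms(1) _ assms(3) [of v]]) simp
  then show ?thesis
    using assms(2) by (auto simp: differentiable_def)
qed

lemma Ck_on_has_derivative:
  assumes "Ck_on (Suc k) S f" "x \<in> S"
  shows "(f has_derivative frechet_derivative f (at x)) (at x)"
  using assms frechet_derivative_works by auto

lemma Ck_on_Suc_imp: "Ck_on (Suc k) S f \<Longrightarrow> Ck_on k S f"
proof (induction k arbitrary: f)
  case 0
  then show ?case
    by (auto intro!: differentiable_imp_continuous_on simp: differentiable_on_def differentiable_at_withinI)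
next
  case (Suc k)
  then have "Ck_on k S (\<lambda>x. frechet_derivative f (at x) v)" for v
    by (intro Suc.IH) (simp only: Ck_on.simps(2) [of "Suc k"])
  then show ?case
    using Suc.prems by simp
qed

lemma Ck_on_const: "Ck_on k S (\<lambda>_. c)"
proof (induction k arbitrary: c)
  case (Suc k)
  then show ?case by simp
qed simp

lemma Ck_on_linear:
  assumes "bounded_linear L" "open S" "Ck_on k S f"
  shows "Ck_on k S (\<lambda>x. L (f x))"
  using assms(3)
proof (induction k arbitrary: f)
  case 0
  then show ?case using assms(1) by (auto intro: bounded_linear.continuous_on)
next
  case (Suc k)
  show ?case
    by (rule Ck_on_SucI [OF assms(2) bounded_linear.has_derivative [OF assms(1) Ck_on_has_derivative [OF Suc.prems]]
          Suc.IH]) (use Suc.prems in auto)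
qed

lemma Ck_on_add:
  assumes "open S" "Ck_on k S f" "Ck_on k S g"
  shows "Ck_on k S (\<lambda>x. f x + g x)"
  using assms(2,3)
proof (induction k arbitrary: f g)
  case 0
  then show ?case by (auto intro: continuous_intros)
next
  case (Suc k)
  show ?case
    by (rule Ck_on_SucI [OF assms(1) has_derivative_add [OF Ck_on_has_derivative [OF Suc.prems(1)]
            Ck_on_has_derivative [OF Suc.prems(2)]] Suc.IH])
      (use Suc.prems in auto)
qed

lemma Ck_on_mult:
  fixes f g :: "'a::real_normed_vector \<Rightarrow> real"
  assumes "open S" "Ck_on k S f" "Ck_on k S g"
  shows "Ck_on k S (\<lambda>x. f x * g x)"
  using assms(2,3)
proof (induction k arbitrary: f g)
  case 0
  then show ?case by (auto intro: continuous_intros)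
next
  case (Suc k)
  show ?case
  proof (rule Ck_on_SucI [OF assms(1) has_derivative_mult [OF Ck_on_has_derivative [OF Suc.prems(1)]
            Ck_on_has_derivative [OF Suc.prems(2)]]])
    fix v
    show "Ck_on k S (\<lambda>x. f x * frechet_derivative g (at x) v + frechet_derivative f (at x) v * g x)"
      using Suc.prems Ck_on_Suc_imp [OF Suc.prems(1)] Ck_on_Suc_imp [OF Suc.prems(2)]
      by (intro Ck_on_add assms(1) Suc.IH) auto
  qed
qed

text \<open>Bootstrapping: the derivative of the reciprocal is a product of the derivative of
  \<open>f\<close> with two copies of the reciprocal, whose regularity of order \<open>k\<close> is
  the induction hypothesis.\<close>

lemma Ck_on_inverse:
  fixes f :: "'a::real_normed_vector \<Rightarrow> real"
  assumes "open S" "Ck_on k S f" "\<And>x. x \<in> S \<Longrightarrow> f x \<noteq> 0"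
  shows "Ck_on k S (\<lambda>x. inverse (f x))"
  using assms(2,3)
proof (induction k arbitrary: f)
  case 0
  then show ?case by (auto intro: continuous_intros)
next
  case (Suc k)
  have inv: "Ck_on k S (\<lambda>x. inverse (f x))"
    by (rule Suc.IH [OF Ck_on_Suc_imp [OF Suc.prems(1)] Suc.prems(2)])
  show ?case
  proof (rule Ck_on_SucI [OF assms(1)])
    fix x assume "x \<in> S"
    then show "((\<lambda>x. inverse (f x)) has_derivative
        (\<lambda>v. - (inverse (f x) * frechet_derivative f (at x) v * inverse (f x)))) (at x)"
      using Suc.prems(2) by (intro Deriv.has_derivative_inverse Ck_on_has_derivative [OF Suc.prems(1)]) auto
  next
    fix v
    have "Ck_on k S (\<lambda>x. (-1) * (inverse (f x) * frechet_derivative f (at x) v * inverse (f x)))"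
      using Suc.prems(1) by (intro Ck_on_mult assms(1) inv Ck_on_const) auto
    then show "Ck_on k S (\<lambda>x. - (inverse (f x) * frechet_derivative f (at x) v * inverse (f x)))"
      by simp
  qed
qed

text \<open>Bootstrapping as for the reciprocal, since the derivative of the root contains the
  reciprocal of the same root.\<close>

lemma Ck_on_sqrt:
  fixes f :: "'a::real_normed_vector \<Rightarrow> real"
  assumes "open S" "Ck_on k S f" "\<And>x. x \<in> S \<Longrightarrow> 0 < f x"
  shows "Ck_on k S (\<lambda>x. sqrt (f x))"
  using assms(2,3)
proof (induction k arbitrary: f)
  case 0
  then show ?case by (auto intro: continuous_intros)
next
  case (Suc k)
  have "Ck_on k S (\<lambda>x. sqrt (f x))"
    by (rule Suc.IH [OF Ck_on_Suc_imp [OF Suc.prems(1)] Suc.prems(2)])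
  then have inv: "Ck_on k S (\<lambda>x. inverse (sqrt (f x)))"
    using Suc.prems(2) by (intro Ck_on_inverse assms(1)) force+
  show ?case
  proof (rule Ck_on_SucI [OF assms(1)])
    fix x assume x: "x \<in> S"
    show "((\<lambda>x. sqrt (f x)) has_derivative
        (\<lambda>v. frechet_derivative f (at x) v * ((1/2) * inverse (sqrt (f x))))) (at x)"
      using DERIV_compose_FDERIV [OF DERIV_real_sqrt [OF Suc.prems(2) [OF x]]
          Ck_on_has_derivative [OF Suc.prems(1) x]]
      by (simp add: mult.commute)
  next
    fix v
    show "Ck_on k S (\<lambda>x. frechet_derivative f (at x) v * ((1/2) * inverse (sqrt (f x))))"
      using Suc.prems(1) by (intro Ck_on_mult assms(1) inv Ck_on_const) auto
  qed
qed

lemma smooth_on_cong: "open S \<Longrightarrow> (\<And>x. x \<in> S \<Longrightarrow> f x = g x) \<Longrightarrow> smooth_on S f \<Longrightarrow> smooth_on S g"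
  unfolding smooth_on_def using Ck_on_cong by metis

lemma smooth_on_subset: "smooth_on S f \<Longrightarrow> T \<subseteq> S \<Longrightarrow> smooth_on T f"
proof -
  have "Ck_on k T f" if "Ck_on k S f" "T \<subseteq> S" for k
    using that(1)
  proof (induction k arbitrary: f)
    case 0
    then show ?case using that(2) by (auto intro: continuous_on_subset)
  next
    case (Suc k)
    then show ?case using that(2) by (simp add: subset_iff)
  qed
  then show "smooth_on S f \<Longrightarrow> T \<subseteq> S \<Longrightarrow> smooth_on T f"
    by (simp add: smooth_on_def)
qed

lemma smooth_on_const: "smooth_on S (\<lambda>_. c)"
  by (simp add: smooth_on_def Ck_on_const)

lemma smooth_on_linear: "bounded_linear L \<Longrightarrow> open S \<Longrightarrow> smooth_on S f \<Longrightarrow> smooth_on S (\<lambda>x. L (f x))"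
  by (simp add: smooth_on_def Ck_on_linear)

lemma smooth_on_add: "open S \<Longrightarrow> smooth_on S f \<Longrightarrow> smooth_on S g \<Longrightarrow> smooth_on S (\<lambda>x. f x + g x)"
  by (simp add: smooth_on_def Ck_on_add)

lemma smooth_on_mult:
  fixes f g :: "'a::real_normed_vector \<Rightarrow> real"
  shows "open S \<Longrightarrow> smooth_on S f \<Longrightarrow> smooth_on S g \<Longrightarrow> smooth_on S (\<lambda>x. f x * g x)"
  by (simp add: smooth_on_def Ck_on_mult)

lemma smooth_on_minus: "open S \<Longrightarrow> smooth_on S f \<Longrightarrow> smooth_on S (\<lambda>x. - f x)"
  using smooth_on_linear [of uminus S f] bounded_linear_minus [OF bounded_linear_ident] by simp

lemma smooth_on_diff: "open S \<Longrightarrow> smooth_on S f \<Longrightarrow> smooth_on S g \<Longrightarrow> smooth_on S (\<lambda>x. f x - g x)"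
  using smooth_on_add [OF _ _ smooth_on_minus, of S f g] by simp

lemma smooth_on_inverse:
  fixes f :: "'a::real_normed_vector \<Rightarrow> real"
  shows "open S \<Longrightarrow> smooth_on S f \<Longrightarrow> (\<And>x. x \<in> S \<Longrightarrow> f x \<noteq> 0) \<Longrightarrow> smooth_on S (\<lambda>x. inverse (f x))"
  by (simp add: smooth_on_def Ck_on_inverse)

lemma smooth_on_sqrt:
  fixes f :: "'a::real_normed_vector \<Rightarrow> real"
  shows "open S \<Longrightarrow> smooth_on S f \<Longrightarrow> (\<And>x. x \<in> S \<Longrightarrow> 0 < f x) \<Longrightarrow> smooth_on S (\<lambda>x. sqrt (f x))"
  by (simp add: smooth_on_def Ck_on_sqrt)

lemma smooth_on_sum:
  assumes "open S" "finite I" "\<And>i. i \<in> I \<Longrightarrow> smooth_on S (f i)"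
  shows "smooth_on S (\<lambda>x. \<Sum>i\<in>I. f i x)"
  using assms(2,3) by (induction I) (auto intro: smooth_on_const smooth_on_add [OF assms(1)])

lemma smooth_on_vec_nth: "open S \<Longrightarrow> smooth_on S f \<Longrightarrow> smooth_on S (\<lambda>x. f x $ i)"
  by (rule smooth_on_linear [OF bounded_linear_vec_nth])

lemma bounded_linear_axis: "bounded_linear (axis i :: real \<Rightarrow> real ^ 'n)"
  by (rule linear_conv_bounded_linear [THEN iffD1], rule linearI) (auto simp: axis_def vec_eq_iff)

lemma smooth_on_vec:
  fixes f :: "'a::real_normed_vector \<Rightarrow> real ^ 'n"
  assumes "open S" "\<And>i. smooth_on S (\<lambda>x. f x $ i)"
  shows "smooth_on S f"
proof -
  have "smooth_on S (\<lambda>x. \<Sum>i\<in>UNIV. axis i (f x $ i))"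
    by (intro smooth_on_sum smooth_on_linear [OF bounded_linear_axis] assms) auto
  moreover have "(\<Sum>i\<in>UNIV. axis i (v $ i)) = v" for v :: "real ^ 'n"
    by (simp add: vec_eq_iff axis_def)
  ultimately show ?thesis by simp
qed

lemma smooth_on_frechet_derivative:
  "smooth_on S f \<Longrightarrow> smooth_on S (\<lambda>x. frechet_derivative f (at x) v)"
  unfolding smooth_on_def using Ck_on.simps(2) by blast

lemma smooth_on_partial: "smooth_on S f \<Longrightarrow> smooth_on S (partial i f)"
  using smooth_on_frechet_derivative by (simp add: partial_def [abs_def])

lemma smooth_on_has_derivative:
  "smooth_on S f \<Longrightarrow> x \<in> S \<Longrightarrow> (f has_derivative frechet_derivative f (at x)) (at x)"
  unfolding smooth_on_def using Ck_on_has_derivative by blast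

lemma smooth_on_differentiable: "smooth_on S f \<Longrightarrow> x \<in> S \<Longrightarrow> f differentiable at x"
  using smooth_on_has_derivative differentiable_def by blast

lemma smooth_on_continuous: "smooth_on S f \<Longrightarrow> continuous_on S f"
  unfolding smooth_on_def using Ck_on.simps(1) by blast

lemma smooth_onI:
  assumes "open S" "\<And>x. x \<in> S \<Longrightarrow> (f has_derivative D x) (at x)" "\<And>v. smooth_on S (\<lambda>x. D x v)"
  shows "smooth_on S f"
  unfolding smooth_on_def
proof
  fix k
  have "Ck_on (Suc k) S f"
    using assms by (intro Ck_on_SucI [of S f D]) (auto simp: smooth_on_def)
  then show "Ck_on k S f"
    by (rule Ck_on_Suc_imp)
qed

section \<open>Symmetry of second derivatives\<close>

lemma has_derivative_compose_at:
  assumes "(g has_derivative g') (at y)" "y = f x" "(f has_derivative f') (at x)"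
  shows "((\<lambda>x. g (f x)) has_derivative (\<lambda>h. g' (f' h))) (at x)"
  using has_derivative_compose [of f f' x UNIV g g'] assms by simp

text \<open>The left side is \<open>q t - q 0\<close> for the difference \<open>q\<close> across the
  parallelogram in direction \<open>w\<close>. The mean value theorem is applied to \<open>q\<close>
  along \<open>v\<close>, and then along \<open>w\<close> to the derivative in direction
  \<open>v\<close>.\<close>

lemma frechet_derivative_second_increment:
  fixes f :: "'a::real_normed_vector \<Rightarrow> real"
  assumes f: "smooth_on S f" and "0 < t"
    and S: "\<And>a b. 0 \<le> a \<Longrightarrow> a \<le> t \<Longrightarrow> 0 \<le> b \<Longrightarrow> b \<le> t \<Longrightarrow> x + a *\<^sub>R v + b *\<^sub>R w \<in> S"
  obtains a b where "0 < a" "a < t" "0 < b" "b < t"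
    "f (x + t *\<^sub>R v + t *\<^sub>R w) - f (x + t *\<^sub>R v) - f (x + t *\<^sub>R w) + f x =
      t * t * frechet_derivative (\<lambda>y. frechet_derivative f (at y) v) (at (x + a *\<^sub>R v + b *\<^sub>R w)) w"
proof -
  let ?D = "\<lambda>y. frechet_derivative f (at y)"
  define q where "q s = f (x + s *\<^sub>R v + t *\<^sub>R w) - f (x + s *\<^sub>R v + 0 *\<^sub>R w)" for s
  have D: "((\<lambda>s. f (x + s *\<^sub>R v + b *\<^sub>R w)) has_real_derivative ?D (x + s *\<^sub>R v + b *\<^sub>R w) v) (at s)"
    if "0 \<le> s" "s \<le> t" "0 \<le> b" "b \<le> t" for s b
  proof -
    have df: "(f has_derivative ?D (x + s *\<^sub>R v + b *\<^sub>R w)) (at (x + s *\<^sub>R v + b *\<^sub>R w))"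
      by (rule smooth_on_has_derivative [OF f S [OF that]])
    have "((\<lambda>s. f (x + s *\<^sub>R v + b *\<^sub>R w)) has_derivative (\<lambda>h. ?D (x + s *\<^sub>R v + b *\<^sub>R w) (h *\<^sub>R v))) (at s)"
      by (rule has_derivative_compose_at [OF df]) (auto intro!: derivative_eq_intros)
    then show ?thesis
      using linear_cmul [OF has_derivative_linear [OF df]]
      by (simp add: has_field_derivative_def mult.commute [of _ "?D _ v"] fun_eq_iff)
  qed
  have "\<exists>a>0. a < t \<and> q t - q 0 = (t - 0) * (?D (x + a *\<^sub>R v + t *\<^sub>R w) v - ?D (x + a *\<^sub>R v + 0 *\<^sub>R w) v)"
    unfolding q_def using \<open>0 < t\<close> by (intro MVT2 DERIV_diff D) auto
  then obtain a where a: "0 < a" "a < t"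
      "q t - q 0 = t * (?D (x + a *\<^sub>R v + t *\<^sub>R w) v - ?D (x + a *\<^sub>R v + 0 *\<^sub>R w) v)"
    by auto
  let ?H = "\<lambda>y. frechet_derivative (\<lambda>y. ?D y v) (at y)"
  have H: "((\<lambda>b. ?D (x + a *\<^sub>R v + b *\<^sub>R w) v) has_real_derivative ?H (x + a *\<^sub>R v + b *\<^sub>R w) w) (at b)"
    if "0 \<le> b" "b \<le> t" for b
  proof -
    have dg: "((\<lambda>y. ?D y v) has_derivative ?H (x + a *\<^sub>R v + b *\<^sub>R w)) (at (x + a *\<^sub>R v + b *\<^sub>R w))"
      using S a that by (intro smooth_on_has_derivative [OF smooth_on_frechet_derivative [OF f]]) auto
    have "((\<lambda>b. ?D (x + a *\<^sub>R v + b *\<^sub>R w) v) has_derivative (\<lambda>h. ?H (x + a *\<^sub>R v + b *\<^sub>R w) (h *\<^sub>R w))) (at b)"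
      by (rule has_derivative_compose_at [OF dg]) (auto intro!: derivative_eq_intros)
    then show ?thesis
      using linear_cmul [OF has_derivative_linear [OF dg]]
      by (simp add: has_field_derivative_def mult.commute [of _ "?H _ w"] fun_eq_iff)
  qed
  have "\<exists>b>0. b < t \<and> ?D (x + a *\<^sub>R v + t *\<^sub>R w) v - ?D (x + a *\<^sub>R v + 0 *\<^sub>R w) v =
      (t - 0) * ?H (x + a *\<^sub>R v + b *\<^sub>R w) w"
    using \<open>0 < t\<close> by (intro MVT2 H) auto
  then obtain b where b: "0 < b" "b < t" "?D (x + a *\<^sub>R v + t *\<^sub>R w) v - ?D (x + a *\<^sub>R v + 0 *\<^sub>R w) v =
      t * ?H (x + a *\<^sub>R v + b *\<^sub>R w) w"
    by auto
  show ?thesis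
    by (rule that [of a b]) (use a b in \<open>auto simp: q_def\<close>)
qed

text \<open>The second difference is symmetric in \<open>v\<close> and \<open>w\<close>, so the two
  mixed derivatives take a common value at two points near \<open>x\<close>. Continuity of both then
  bounds their distance at \<open>x\<close> by any positive \<open>e\<close>.\<close>

lemma frechet_derivative_second_symmetric:
  fixes f :: "'a::real_normed_vector \<Rightarrow> real"
  assumes f: "smooth_on S f" and "open S" "x \<in> S"
  shows "frechet_derivative (\<lambda>y. frechet_derivative f (at y) v) (at x) w =
    frechet_derivative (\<lambda>y. frechet_derivative f (at y) w) (at x) v"
proof -
  let ?H = "\<lambda>v w y. frechet_derivative (\<lambda>y. frechet_derivative f (at y) v) (at y) w"
  have "\<bar>?H v w x - ?H w v x\<bar> \<le> e" if e: "0 < e" for e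
  proof -
    have "continuous (at x) (?H v w)" "continuous (at x) (?H w v)"
      using smooth_on_continuous [OF smooth_on_frechet_derivative [OF smooth_on_frechet_derivative [OF f]]]
        assms continuous_on_eq_continuous_at by blast+
    moreover have "\<exists>d>0. \<forall>y. dist y x < d \<longrightarrow> dist (F y) (F x) < e / 2"
      if "continuous (at x) F" for F :: "'a \<Rightarrow> real"
      using that e unfolding continuous_at_eps_delta by (meson half_gt_zero)
    ultimately obtain d1 d2 where d: "d1 > 0" "\<And>y. dist y x < d1 \<Longrightarrow> dist (?H v w y) (?H v w x) < e / 2"
      "d2 > 0" "\<And>y. dist y x < d2 \<Longrightarrow> dist (?H w v y) (?H w v x) < e / 2"
      by meson
    obtain r where r: "r > 0" "ball x r \<subseteq> S"
      using assms openE by blast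
    define m where "m = min r (min d1 d2)"
    \<comment> \<open>The summand 1 keeps \<open>c\<close> positive when \<open>v\<close> and
      \<open>w\<close> vanish. With \<open>t = m / (2 * c)\<close> the parallelogram stays within
      distance \<open>m / 2\<close> of \<open>x\<close>.\<close>
    define c where "c = norm v + norm w + 1"
    define t where "t = m / (2 * c)"
    have m: "m > 0" using r d by (simp add: m_def)
    have c: "c > 0" using norm_ge_zero [of v] norm_ge_zero [of w] unfolding c_def by linarith
    have t: "0 < t" using m c by (simp add: t_def)
    have near: "dist (x + a *\<^sub>R v + b *\<^sub>R w) x < m" if "0 \<le> a" "a \<le> t" "0 \<le> b" "b \<le> t" for a b
    proof -
      have "dist (x + a *\<^sub>R v + b *\<^sub>R w) x \<le> a * norm v + b * norm w"
        using norm_triangle_ineq [of "a *\<^sub>R v" "b *\<^sub>R w"] that by (simp add: dist_norm add.assoc)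
      also have "\<dots> \<le> t * norm v + t * norm w"
        using that by (intro add_mono mult_right_mono) auto
      also have "\<dots> \<le> t * c"
        using t by (simp add: c_def algebra_simps)
      also have "\<dots> = m / 2"
        using c by (simp add: t_def)
      also have "\<dots> < m"
        using m by simp
      finally show ?thesis .
    qed
    have near': "dist (x + a *\<^sub>R w + b *\<^sub>R v) x < m" if "0 \<le> a" "a \<le> t" "0 \<le> b" "b \<le> t" for a b
      using near [of b a] that by (simp add: algebra_simps)
    have S: "x + a *\<^sub>R v + b *\<^sub>R w \<in> S" "x + a *\<^sub>R w + b *\<^sub>R v \<in> S"
      if "0 \<le> a" "a \<le> t" "0 \<le> b" "b \<le> t" for a b
      using near [OF that] near' [OF that] r(2) by (auto simp: m_def dist_commute)
    obtain a b where ab: "0 < a" "a < t" "0 < b" "b < t"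
      "f (x + t *\<^sub>R v + t *\<^sub>R w) - f (x + t *\<^sub>R v) - f (x + t *\<^sub>R w) + f x =
        t * t * ?H v w (x + a *\<^sub>R v + b *\<^sub>R w)"
      using frechet_derivative_second_increment [OF f t S(1)] by blast
    obtain a' b' where ab': "0 < a'" "a' < t" "0 < b'" "b' < t"
      "f (x + t *\<^sub>R w + t *\<^sub>R v) - f (x + t *\<^sub>R w) - f (x + t *\<^sub>R v) + f x =
        t * t * ?H w v (x + a' *\<^sub>R w + b' *\<^sub>R v)"
      using frechet_derivative_second_increment [OF f t S(2)] by blast
    have swap: "x + t *\<^sub>R w + t *\<^sub>R v = x + t *\<^sub>R v + t *\<^sub>R w"
      by (simp add: algebra_simps)
    have "t * t * ?H v w (x + a *\<^sub>R v + b *\<^sub>R w) = t * t * ?H w v (x + a' *\<^sub>R w + b' *\<^sub>R v)"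
      using ab(5) ab'(5) unfolding swap by linarith
    then have "?H v w (x + a *\<^sub>R v + b *\<^sub>R w) = ?H w v (x + a' *\<^sub>R w + b' *\<^sub>R v)"
      using t by simp
    moreover have "dist (?H v w (x + a *\<^sub>R v + b *\<^sub>R w)) (?H v w x) < e / 2"
      using ab near [of a b] by (intro d) (auto simp: m_def)
    moreover have "dist (?H w v (x + a' *\<^sub>R w + b' *\<^sub>R v)) (?H w v x) < e / 2"
      using ab' near' [of a' b'] by (intro d) (auto simp: m_def)
    ultimately show ?thesis
      unfolding dist_real_def by argo
  qed
  then show ?thesis
    using field_le_epsilon [of "\<bar>?H v w x - ?H w v x\<bar>" 0] by force
qed

text \<open>The Poincare lemma by radial integration: \<open>f x\<close> is the line integral of
  \<alpha> along the segment from \<open>a\<close> to \<open>x\<close>. Closedness turns the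
  derivative of the integrand in direction \<open>v\<close> into the \<open>t\<close>-derivative of
  \<open>t * (\<alpha> (\<gamma> x t) \<bullet> v)\<close>, whose integral is
  \<open>\<alpha> x \<bullet> v\<close>.\<close>

lemma smooth_primitive_on_ball:
  fixes \<alpha> :: "'a::euclidean_space \<Rightarrow> 'a"
  assumes \<alpha>: "smooth_on (ball a r) \<alpha>"
    and closed: "\<And>x v w. x \<in> ball a r \<Longrightarrow>
      frechet_derivative \<alpha> (at x) v \<bullet> w = frechet_derivative \<alpha> (at x) w \<bullet> v"
  obtains f where "\<And>x. x \<in> ball a r \<Longrightarrow> (f has_derivative (\<lambda>v. \<alpha> x \<bullet> v)) (at x)"
proof
  let ?B = "ball a r"
  let ?D = "\<lambda>x. frechet_derivative \<alpha> (at x)"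
  define \<gamma> where "\<gamma> x t = a + t *\<^sub>R (x - a)" for x :: 'a and t :: real
  define f where "f x = integral (cbox 0 1) (\<lambda>t. \<alpha> (\<gamma> x t) \<bullet> (x - a))" for x
  have \<gamma>: "\<gamma> x t \<in> ?B" if "x \<in> ?B" "t \<in> cbox 0 1" for x t
  proof -
    have "dist a (\<gamma> x t) = t * dist a x"
      using that by (simp add: \<gamma>_def dist_norm norm_minus_commute)
    also have "\<dots> \<le> dist a x"
      using that by (simp add: mult_left_le_one_le)
    finally show ?thesis using that by simp
  qed
  have cont_\<gamma>: "continuous_on (?B \<times> cbox 0 1) (\<lambda>(x, t). \<gamma> x t)"
    unfolding \<gamma>_def split_beta by (intro continuous_intros)
  have cont_\<alpha>: "continuous_on (?B \<times> cbox 0 1) (\<lambda>(x, t). \<alpha> (\<gamma> x t))"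
    unfolding split_beta
    by (rule continuous_on_compose2 [OF smooth_on_continuous [OF \<alpha>] cont_\<gamma> [unfolded split_beta]])
      (use \<gamma> in force)
  have cont_D: "continuous_on (?B \<times> cbox 0 1) (\<lambda>(x, t). ?D (\<gamma> x t) v)" for v
    unfolding split_beta
    by (rule continuous_on_compose2 [OF smooth_on_continuous [OF smooth_on_frechet_derivative [OF \<alpha>, of v]]
          cont_\<gamma> [unfolded split_beta]]) (use \<gamma> in force)
  have D: "(\<alpha> has_derivative ?D (\<gamma> x t)) (at (\<gamma> x t))" if "x \<in> ?B" "t \<in> cbox 0 1" for x t
    by (rule smooth_on_has_derivative [OF \<alpha> \<gamma> [OF that]])
  note lin = linear_cmul [OF has_derivative_linear [OF D]]
  define \<phi> where "\<phi> x t v = t * (?D (\<gamma> x t) v \<bullet> (x - a)) + \<alpha> (\<gamma> x t) \<bullet> v" for x t v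
  have \<phi>: "((\<lambda>x. \<alpha> (\<gamma> x t) \<bullet> (x - a)) has_derivative \<phi> x t) (at x)" if "x \<in> ?B" "t \<in> cbox 0 1" for x t
  proof -
    have "((\<lambda>x. \<gamma> x t) has_derivative (\<lambda>v. t *\<^sub>R v)) (at x)"
      unfolding \<gamma>_def by (auto intro!: derivative_eq_intros)
    then have "((\<lambda>x. \<alpha> (\<gamma> x t)) has_derivative (\<lambda>v. ?D (\<gamma> x t) (t *\<^sub>R v))) (at x)"
      by (intro has_derivative_compose_at [OF D [OF that]] refl)
    then show ?thesis
      by (rule has_derivative_eq_rhs [OF has_derivative_inner])
        (auto intro!: derivative_eq_intros simp: \<phi>_def lin [OF that] fun_eq_iff)
  qed
  \<comment> \<open>Differentiation under the integral by \<open>leibniz_rule\<close> wants the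
    derivative as an element of the space of bounded linear maps.\<close>
  define \<Phi> where "\<Phi> x t = Blinfun (\<phi> x t)" for x t
  have \<Phi>: "blinfun_apply (\<Phi> x t) = \<phi> x t" if "x \<in> ?B" "t \<in> cbox 0 1" for x t
    unfolding \<Phi>_def by (rule bounded_linear_Blinfun_apply [OF has_derivative_bounded_linear [OF \<phi> [OF that]]])
  fix x assume x: "x \<in> ?B"
  have cont_\<Phi>: "continuous_on (?B \<times> cbox 0 1) (\<lambda>(x, t). \<Phi> x t)"
  proof (rule continuous_on_blinfun_componentwise)
    fix v :: 'a
    have "continuous_on (?B \<times> cbox 0 1) (\<lambda>z. snd z * (?D (\<gamma> (fst z) (snd z)) v \<bullet> (fst z - a)) + \<alpha> (\<gamma> (fst z) (snd z)) \<bullet> v)"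
      using cont_D [of v] cont_\<alpha> unfolding split_beta by (intro continuous_intros)
    then show "continuous_on (?B \<times> cbox 0 1) (\<lambda>z. blinfun_apply (case z of (x, t) \<Rightarrow> \<Phi> x t) v)"
      by (rule continuous_on_eq) (auto simp: \<Phi> \<phi>_def)
  qed
  have cont1: "continuous_on (cbox 0 1) (\<lambda>t. g x t)"
    if "continuous_on (?B \<times> cbox 0 1) (\<lambda>(x, t). g x t)" "x \<in> ?B" for x and g :: "'a \<Rightarrow> real \<Rightarrow> 'b::topological_space"
  proof -
    have "continuous_on (cbox 0 1) (\<lambda>t. case (x, t) of (x, t) \<Rightarrow> g x t)"
      by (rule continuous_on_compose2 [OF that(1)]) (use that(2) in \<open>auto intro!: continuous_intros\<close>)
    then show ?thesis by simp
  qed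
  have "(f has_derivative integral (cbox 0 1) (\<Phi> x)) (at x within ?B)"
    unfolding f_def
  proof (rule leibniz_rule [OF _ _ cont_\<Phi> x])
    fix y t assume "y \<in> ?B" "t \<in> cbox 0 (1::real)"
    then show "((\<lambda>x. \<alpha> (\<gamma> x t) \<bullet> (x - a)) has_derivative blinfun_apply (\<Phi> y t)) (at y within ?B)"
      using \<phi> \<Phi> by (auto intro: has_derivative_at_withinI)
  next
    fix y assume "y \<in> ?B"
    then show "(\<lambda>t. \<alpha> (\<gamma> y t) \<bullet> (y - a)) integrable_on cbox 0 1"
      using cont1 [OF cont_\<alpha>] by (intro integrable_continuous continuous_intros)
  qed simp
  then have f: "(f has_derivative integral (cbox 0 1) (\<Phi> x)) (at x)"
    by (simp only: at_within_open [OF x open_ball])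
  have "blinfun_apply (integral (cbox 0 1) (\<Phi> x)) v = \<alpha> x \<bullet> v" for v
  proof -
    have "\<Phi> x integrable_on cbox 0 1"
      by (rule integrable_continuous [OF cont1 [OF cont_\<Phi> x]])
    then have "blinfun_apply (integral (cbox 0 1) (\<Phi> x)) v = integral (cbox 0 1) (\<lambda>t. \<Phi> x t v)"
      by (rule blinfun_apply_integral)
    also have "\<dots> = integral (cbox 0 1) (\<lambda>t. \<phi> x t v)"
      by (rule integral_cong) (subst \<Phi> [OF x], auto)
    also have "\<dots> = 1 * (\<alpha> (\<gamma> x 1) \<bullet> v) - 0 * (\<alpha> (\<gamma> x 0) \<bullet> v)"
    proof -
      have "((\<lambda>t. \<phi> x t v) has_integral 1 * (\<alpha> (\<gamma> x 1) \<bullet> v) - 0 * (\<alpha> (\<gamma> x 0) \<bullet> v)) {0..1}"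
      proof (rule fundamental_theorem_of_calculus)
        fix t :: real assume t: "t \<in> {0..1}"
        then have t': "t \<in> cbox 0 1" by simp
        have "((\<lambda>t. \<gamma> x t) has_derivative (\<lambda>h. h *\<^sub>R (x - a))) (at t)"
          unfolding \<gamma>_def by (auto intro!: derivative_eq_intros)
        then have "((\<lambda>t. \<alpha> (\<gamma> x t)) has_derivative (\<lambda>h. ?D (\<gamma> x t) (h *\<^sub>R (x - a)))) (at t)"
          by (intro has_derivative_compose_at [OF D [OF x t']] refl)
        \<comment> \<open>Closedness enters here: it exchanges \<open>v\<close> and
          \<open>x - a\<close>, the direction in which the segment runs.\<close>
        then have "((\<lambda>t. t * (\<alpha> (\<gamma> x t) \<bullet> v)) has_derivative (\<lambda>h. h * \<phi> x t v)) (at t)"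
          by (rule has_derivative_eq_rhs [OF has_derivative_mult [OF has_derivative_ident has_derivative_inner_left]])
            (simp add: fun_eq_iff lin [OF x t'] \<phi>_def closed [OF \<gamma> [OF x t'], of v] distrib_left mult.left_commute)
        then show "((\<lambda>t. t * (\<alpha> (\<gamma> x t) \<bullet> v)) has_vector_derivative \<phi> x t v) (at t within {0..1})"
          by (simp add: has_vector_derivative_def has_derivative_at_withinI)
      qed simp
      then show ?thesis by (simp add: integral_unique)
    qed
    finally show ?thesis by (simp add: \<gamma>_def)
  qed
  then have "blinfun_apply (integral (cbox 0 1) (\<Phi> x)) = (\<lambda>v. \<alpha> x \<bullet> v)" by (simp add: fun_eq_iff)
  with f show "(f has_derivative (\<lambda>v. \<alpha> x \<bullet> v)) (at x)" by simp
qed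

section \<open>Conjugate functions in a chart\<close>

lemma partial_eqI: "(f has_derivative D) (at x) \<Longrightarrow> partial i f x = D (axis i 1)"
  unfolding partial_def using frechet_derivative_at by metis

lemma differentiable_has_derivative:
  "f differentiable at x \<Longrightarrow> (f has_derivative frechet_derivative f (at x)) (at x)"
  using frechet_derivative_works by blast

lemma partial_cong:
  assumes "open V" "x \<in> V" "\<And>y. y \<in> V \<Longrightarrow> f y = g y"
  shows "partial i f x = partial i g x"
proof -
  have "(f has_derivative D) (at x) \<longleftrightarrow> (g has_derivative D) (at x)" for D
    using has_derivative_transform_within_open [OF _ assms(1,2)] assms(3) by metis
  then show ?thesis
    by (simp add: partial_def frechet_derivative_def)
qed

lemma partial_const: "partial i (\<lambda>_. c) x = 0"
  by (simp add: partial_def)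

lemma partial_add:
  assumes "f differentiable at x" "g differentiable at x"
  shows "partial i (\<lambda>y. f y + g y) x = partial i f x + partial i g x"
  using partial_eqI [OF has_derivative_add [OF differentiable_has_derivative [OF assms(1)] differentiable_has_derivative [OF assms(2)]]]
  by (simp add: partial_def)

lemma partial_minus:
  assumes "f differentiable at x"
  shows "partial i (\<lambda>y. - f y) x = - partial i f x"
  using partial_eqI [OF has_derivative_minus [OF differentiable_has_derivative [OF assms]]]
  by (simp add: partial_def)

lemma partial_diff:
  assumes "f differentiable at x" "g differentiable at x"
  shows "partial i (\<lambda>y. f y - g y) x = partial i f x - partial i g x"
  using partial_eqI [OF has_derivative_diff [OF differentiable_has_derivative [OF assms(1)]
      differentiable_has_derivative [OF assms(2)]]]
  by (simp add: partial_def)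

lemma partial_mult:
  assumes "f differentiable at x" "g differentiable at x"
  shows "partial i (\<lambda>y. f y * g y) x = f x * partial i g x + partial i f x * g x"
  using partial_eqI [OF has_derivative_mult [OF differentiable_has_derivative [OF assms(1)] differentiable_has_derivative [OF assms(2)]]]
  by (simp add: partial_def)

lemma partial_cmult:
  assumes "f differentiable at x"
  shows "partial i (\<lambda>y. c * f y) x = c * partial i f x"
  using partial_mult [OF differentiable_const assms] by (simp add: partial_const)

lemma partial_inverse:
  assumes "f differentiable at x" "f x \<noteq> 0"
  shows "partial i (\<lambda>y. inverse (f y)) x = - (inverse (f x) * partial i f x * inverse (f x))"
  using partial_eqI [OF Deriv.has_derivative_inverse [OF assms(2) differentiable_has_derivative [OF assms(1)]]]
  by (simp add: partial_def)

lemma has_derivative_sqrt_compose: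
  assumes "(f has_derivative D) (at x)" "0 < f x"
  shows "((\<lambda>y. sqrt (f y)) has_derivative (\<lambda>v. D v * (inverse (sqrt (f x)) / 2))) (at x)"
  using DERIV_compose_FDERIV [OF DERIV_real_sqrt [OF assms(2)] assms(1)] by simp

lemma partial_sqrt:
  assumes "f differentiable at x" "0 < f x"
  shows "partial i (\<lambda>y. sqrt (f y)) x = partial i f x * (inverse (sqrt (f x)) / 2)"
  using partial_eqI [OF has_derivative_sqrt_compose [OF differentiable_has_derivative [OF assms(1)] assms(2)]]
  by (simp add: partial_def)

lemma has_derivative_eq_partials:
  fixes f :: "real^2 \<Rightarrow> real"
  assumes "f differentiable at x"
  shows "frechet_derivative f (at x) v = partial 1 f x * v $ 1 + partial 2 f x * v $ 2"
proof -
  interpret D: bounded_linear "frechet_derivative f (at x)"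
    using assms has_derivative_bounded_linear frechet_derivative_works by blast
  have v: "v = v $ 1 *\<^sub>R axis 1 1 + v $ 2 *\<^sub>R axis 2 1"
    by (simp add: vec_eq_iff forall_2 axis_def)
  have "frechet_derivative f (at x) v = v $ 1 * partial 1 f x + v $ 2 * partial 2 f x"
    by (subst v) (simp add: D.add D.scaleR partial_def)
  then show ?thesis by simp
qed

lemma partial_partial_commute:
  assumes "smooth_on V f" "open V" "x \<in> V"
  shows "partial i (partial j f) x = partial j (partial i f) x"
  using frechet_derivative_second_symmetric [OF assms] by (simp add: partial_def [abs_def])

text \<open>Vanishing curl is symmetry of the Jacobian matrix, the form of closedness that
  \<open>smooth_primitive_on_ball\<close> expects.\<close>

lemma closed_form_symmetric:
  fixes \<alpha> :: "real^2 \<Rightarrow> real^2"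
  assumes "\<alpha> differentiable at x"
    and "partial 1 (\<lambda>y. \<alpha> y $ 2) x = partial 2 (\<lambda>y. \<alpha> y $ 1) x"
  shows "frechet_derivative \<alpha> (at x) v \<bullet> w = frechet_derivative \<alpha> (at x) w \<bullet> v"
proof -
  have \<alpha>: "(\<alpha> has_derivative frechet_derivative \<alpha> (at x)) (at x)"
    using assms(1) frechet_derivative_works by blast
  have i: "((\<lambda>y. \<alpha> y $ i) has_derivative (\<lambda>v. frechet_derivative \<alpha> (at x) v $ i)) (at x)" for i
    by (rule bounded_linear.has_derivative [OF bounded_linear_vec_nth \<alpha>])
  have "frechet_derivative \<alpha> (at x) v $ i =
      partial 1 (\<lambda>y. \<alpha> y $ i) x * v $ 1 + partial 2 (\<lambda>y. \<alpha> y $ i) x * v $ 2" for i v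
    using has_derivative_eq_partials [of "\<lambda>y. \<alpha> y $ i" x v] i [of i] frechet_derivative_at [OF i [of i]]
    by (metis differentiable_def)
  then show ?thesis
    using assms(2) by (simp add: inner_vec_def sum_2 algebra_simps)
qed

text \<open>The operator \<open>J\<close> for the inner product \<open>H\<close> and the orientation
  of the coordinates: the index is lowered with \<open>H\<close>, the covector is turned, and the
  result is divided by the area density. For the identity matrix it is the usual rotation.\<close>

definition quarter_turn :: "real^2^2 \<Rightarrow> real^2 \<Rightarrow> real^2" where
  "quarter_turn H v = inverse (sqrt (det H)) *\<^sub>R vector [- (H *v v) $ 2, (H *v v) $ 1]"

lemmas coord2 = vec_eq_iff forall_2 sum_2 matrix_vector_mult_def inner_vec_def det_2

text \<open>Let \<open>R\<close> be the coordinate rotation. Then \<open>quarter_turn\<close> is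
  \<open>R H / sqrt (det H)\<close>, and symmetry of \<open>H\<close> gives
  \<open>H R H = (det H) R\<close>, hence the first claim. The other two follow from it because
  \<open>R\<close> is an isometry of the dot product with square -1.\<close>

lemma
  assumes H: "H $ 2 $ 1 = H $ 1 $ 2" "0 < det H"
  shows metric_quarter_turn: "H *v quarter_turn H v = sqrt (det H) *\<^sub>R vector [- v $ 2, v $ 1]"
    and quarter_turn_quarter_turn: "quarter_turn H (quarter_turn H v) = - v"
    and inner_quarter_turn: "quarter_turn H v \<bullet> (H *v quarter_turn H v) = v \<bullet> (H *v v)"
proof -
  have det: "det H * inverse (sqrt (det H)) = sqrt (det H)"
    using H(2) real_sqrt_mult_self [of "det H"] by (simp add: field_simps)
  have "H *v quarter_turn H v = (det H * inverse (sqrt (det H))) *\<^sub>R vector [- v $ 2, v $ 1]"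
    unfolding quarter_turn_def using H(1) by (simp add: coord2) (simp add: algebra_simps)
  then show 1: "H *v quarter_turn H v = sqrt (det H) *\<^sub>R vector [- v $ 2, v $ 1]"
    by (simp only: det)
  have inv: "inverse (sqrt (det H)) * sqrt (det H) = 1"
    using H(2) by simp
  show "quarter_turn H (quarter_turn H v) = - v"
    unfolding quarter_turn_def [of H "quarter_turn H v"] 1
    using inv by (simp add: vec_eq_iff forall_2)
  have "quarter_turn H v \<bullet> (H *v quarter_turn H v) =
      (inverse (sqrt (det H)) * sqrt (det H)) * (v \<bullet> (H *v v))"
    unfolding 1 unfolding quarter_turn_def
    by (simp add: inner_vec_def sum_2) (simp add: distrib_left mult_ac)
  then show "quarter_turn H v \<bullet> (H *v quarter_turn H v) = v \<bullet> (H *v v)"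
    by (simp only: inv mult_1)
qed

lemma quarter_turn_scaleR: "quarter_turn H (c *\<^sub>R v) = c *\<^sub>R quarter_turn H v"
  by (simp add: quarter_turn_def matrix_vector_mult_scaleR vec_eq_iff forall_2)

lemma quarter_turn_zero: "quarter_turn H 0 = 0"
  using quarter_turn_scaleR [of H 0 0] by simp

definition flux :: "real \<Rightarrow> (real^2 \<Rightarrow> real^2^2) \<Rightarrow> (real^2 \<Rightarrow> real) \<Rightarrow> real^2 \<Rightarrow> real^2" where
  "flux \<kappa> h u y = gradient h u y /\<^sub>R sqrt (1 + \<kappa> * (metric_norm h y (gradient h u y))\<^sup>2)"

text \<open>The covector dual to \<open>J X\<close>, which is the contraction of the area form with
  \<open>X\<close>. In this form no reciprocal of the density occurs, and its curl is the expression
  in \<open>volume_divergence\<close>.\<close>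

definition conjugate_form :: "(real^2 \<Rightarrow> real^2^2) \<Rightarrow> (real^2 \<Rightarrow> real^2) \<Rightarrow> real^2 \<Rightarrow> real^2" where
  "conjugate_form h X y = sqrt (det (h y)) *\<^sub>R vector [- X y $ 2, X y $ 1]"

locale metric_patch =
  fixes V :: "(real^2) set" and h :: "real^2 \<Rightarrow> real^2^2"
  assumes open_V: "open V"
    and smooth_h: "smooth_on V h"
    and symmetric: "x \<in> V \<Longrightarrow> transpose (h x) = h x"
    and positive: "\<lbrakk>x \<in> V; v \<noteq> 0\<rbrakk> \<Longrightarrow> v \<bullet> (h x *v v) > 0"
begin

section \<open>Determinant, inverse and smoothness in one coordinate patch\<close>

lemma h21:
  assumes "x \<in> V"
  shows "h x $ 2 $ 1 = h x $ 1 $ 2"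
proof -
  have "transpose (h x) $ 2 $ 1 = h x $ 2 $ 1"
    by (simp only: symmetric [OF assms])
  then show ?thesis by (simp add: transpose_def)
qed

lemma det_pos:
  assumes x: "x \<in> V"
  shows "0 < det (h x)"
proof -
  let ?E = "h x $ 1 $ 1" and ?F = "h x $ 1 $ 2" and ?G = "h x $ 2 $ 2"
  have E: "?E > 0"
    using positive [OF x, of "vector [1, 0]"] by (simp add: coord2)
  \<comment> \<open>On this vector the quadratic form takes the value
    \<open>?E * (?E * ?G - ?F * ?F)\<close>, that is, \<open>?E\<close> times the
    determinant.\<close>
  have "vector [- ?F, ?E] \<noteq> (0 :: real^2)"
    using E by (simp add: coord2)
  from positive [OF x this] have "?E * det (h x) > 0"
    using h21 [OF x] by (simp add: coord2 algebra_simps)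
  then show ?thesis
    using E zero_less_mult_pos by blast
qed

lemma invertible_h: "x \<in> V \<Longrightarrow> invertible (h x)"
  using det_pos invertible_det_nz by (metis less_irrefl)

lemma matrix_inv_mult:
  assumes "x \<in> V"
  shows "matrix_inv (h x) *v (h x *v v) = v" "h x *v (matrix_inv (h x) *v v) = v"
  using matrix_inv_inverse [OF invertible_h [OF assms]] by (simp_all add: matrix_vector_mul_assoc)

text \<open>Cramer's rule. Since \<open>matrix_inv\<close> is defined by choice, smoothness of the
  gradient is read off from this formula.\<close>

lemma matrix_inv_eq:
  assumes x: "x \<in> V"
  shows "matrix_inv (h x) *v v = inverse (det (h x)) *\<^sub>R
    vector [h x $ 2 $ 2 * v $ 1 - h x $ 1 $ 2 * v $ 2, h x $ 1 $ 1 * v $ 2 - h x $ 1 $ 2 * v $ 1]"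
    (is "_ = ?u")
proof -
  have "h x *v ?u = (det (h x) * inverse (det (h x))) *\<^sub>R v"
    using h21 [OF x] by (simp add: coord2) (simp add: algebra_simps)
  also have "\<dots> = v"
    using det_pos [OF x] by simp
  finally show ?thesis
    using matrix_inv_mult(1) [OF x] by metis
qed

lemma smooth_entry: "smooth_on V (\<lambda>y. h y $ i $ j)"
  by (intro smooth_on_vec_nth open_V smooth_h)

lemma smooth_det: "smooth_on V (\<lambda>y. det (h y))"
  unfolding det_2 by (intro smooth_on_diff smooth_on_mult smooth_entry open_V)

lemma smooth_volume: "smooth_on V (\<lambda>y. sqrt (det (h y)))"
  by (intro smooth_on_sqrt smooth_det open_V det_pos)

lemma smooth_gradient:
  assumes "smooth_on V f"
  shows "smooth_on V (gradient h f)"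
proof (rule smooth_on_vec [OF open_V])
  fix i :: 2
  let ?k = "\<lambda>y. inverse (det (h y))"
  have k: "smooth_on V ?k"
    using det_pos by (intro smooth_on_inverse smooth_det open_V) force
  consider "i = 1" | "i = 2" using exhaust_2 by blast
  then show "smooth_on V (\<lambda>y. gradient h f y $ i)"
  proof cases
    case 1
    have "smooth_on V (\<lambda>y. ?k y * (h y $ 2 $ 2 * partial 1 f y - h y $ 1 $ 2 * partial 2 f y))"
      by (intro smooth_on_mult smooth_on_diff smooth_entry smooth_on_partial assms k open_V)
    then show ?thesis
      by (rule smooth_on_cong [OF open_V, rotated]) (simp add: 1 gradient_def matrix_inv_eq)
  next
    case 2
    have "smooth_on V (\<lambda>y. ?k y * (h y $ 1 $ 1 * partial 2 f y - h y $ 1 $ 2 * partial 1 f y))"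
      by (intro smooth_on_mult smooth_on_diff smooth_entry smooth_on_partial assms k open_V)
    then show ?thesis
      by (rule smooth_on_cong [OF open_V, rotated]) (simp add: 2 gradient_def matrix_inv_eq)
  qed
qed

lemma smooth_inner:
  assumes "smooth_on V X"
  shows "smooth_on V (\<lambda>y. X y \<bullet> (h y *v X y))"
  unfolding inner_vec_def matrix_vector_mult_def sum_2 vec_lambda_beta inner_real_def
  by (intro smooth_on_add smooth_on_mult smooth_entry smooth_on_vec_nth assms open_V)

lemma smooth_scaleR:
  assumes "smooth_on V f" "smooth_on V X"
  shows "smooth_on V (\<lambda>y. f y *\<^sub>R (X y :: real^2))"
  by (rule smooth_on_vec [OF open_V])
    (simp, intro smooth_on_mult smooth_on_vec_nth assms open_V)

lemma smooth_quarter_turn: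
  assumes "smooth_on V X"
  shows "smooth_on V (\<lambda>y. quarter_turn (h y) (X y))"
  unfolding quarter_turn_def
proof (rule smooth_scaleR)
  show "smooth_on V (\<lambda>y. inverse (sqrt (det (h y))))"
    using det_pos by (intro smooth_on_inverse smooth_volume open_V) force
  show "smooth_on V (\<lambda>y. vector [- (h y *v X y) $ 2, (h y *v X y) $ 1] :: real^2)"
  proof (rule smooth_on_vec [OF open_V])
    fix i :: 2
    have c: "smooth_on V (\<lambda>y. (h y *v X y) $ j)" for j
      unfolding matrix_vector_mult_def sum_2 vec_lambda_beta
      by (intro smooth_on_add smooth_on_mult smooth_entry smooth_on_vec_nth assms open_V)
    show "smooth_on V (\<lambda>y. (vector [- (h y *v X y) $ 2, (h y *v X y) $ 1] :: real^2) $ i)"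
      using exhaust_2 [of i] c smooth_on_minus [OF open_V c] by auto
  qed
qed

lemma differentiable_entry: "x \<in> V \<Longrightarrow> (\<lambda>y. h y $ i $ j) differentiable at x"
  by (rule smooth_on_differentiable [OF smooth_entry])

lemma differentiable_component: "smooth_on V X \<Longrightarrow> x \<in> V \<Longrightarrow> (\<lambda>y. X y $ i) differentiable at x"
  by (rule smooth_on_differentiable [OF smooth_on_vec_nth [OF open_V]])

lemma eventually_symmetric: "x \<in> V \<Longrightarrow> \<forall>\<^sub>F y in nhds x. transpose (h y) = h y"
  using symmetric open_V by (auto simp: eventually_nhds)

section \<open>Volume, divergence and covariant derivatives in one patch\<close>

lemma partial_metric:
  assumes "x \<in> V"
  shows "partial k (\<lambda>y. h y $ i $ j) x =
    christoffel h 1 k i x * h x $ 1 $ j + christoffel h 2 k i x * h x $ 2 $ j +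
    (christoffel h 1 k j x * h x $ i $ 1 + christoffel h 2 k j x * h x $ i $ 2)"
  using christoffel_metric_compatible [where h = h and x = x, OF invertible_h [OF assms] eventually_symmetric [OF assms]]
  by (simp add: sum_2)

text \<open>Metric compatibility makes the derivative of the determinant twice the contracted
  Christoffel symbol times the determinant; the root halves the factor.\<close>

lemma partial_volume:
  assumes x: "x \<in> V"
  shows "partial k (\<lambda>y. sqrt (det (h y))) x =
    (christoffel h 1 k 1 x + christoffel h 2 k 2 x) * sqrt (det (h x))"
proof -
  note d = differentiable_entry [OF x]
  have "partial k (\<lambda>y. det (h y)) x = 2 * (christoffel h 1 k 1 x + christoffel h 2 k 2 x) * det (h x)"
    unfolding det_2
    by (simp add: partial_diff partial_mult differentiable_mult d
        partial_metric [OF x] h21 [OF x]) (simp add: algebra_simps)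
  moreover have "det (h x) * inverse (sqrt (det (h x))) = sqrt (det (h x))"
    using det_pos [OF x] real_sqrt_mult_self [of "det (h x)"] by (simp add: field_simps)
  ultimately show ?thesis
    using partial_sqrt [OF smooth_on_differentiable [OF smooth_det x] det_pos [OF x], of k]
    by (simp add: mult.assoc) (simp add: algebra_simps)
qed

text \<open>The Voss-Weyl formula: after a swap of lower indices by torsion freeness, the
  Christoffel terms in the trace are the logarithmic derivative of the volume density.\<close>

lemma volume_divergence:
  assumes X: "smooth_on V X" and x: "x \<in> V"
  shows "sqrt (det (h x)) * divergence h X x =
    partial 1 (\<lambda>y. sqrt (det (h y)) * X y $ 1) x + partial 2 (\<lambda>y. sqrt (det (h y)) * X y $ 2) x"
proof -
  have torsion: "christoffel h k 2 1 x = christoffel h k 1 2 x" for k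
    by (rule christoffel_torsion_free [OF eventually_symmetric [OF x]])
  show ?thesis
    by (simp add: divergence_def cov_deriv_def sum_2 torsion partial_volume [OF x]
        partial_mult [OF smooth_on_differentiable [OF smooth_volume x] differentiable_component [OF X x]])
      (simp add: algebra_simps)
qed

lemma cov_deriv_scaleR:
  assumes "smooth_on V f" "smooth_on V X" "x \<in> V"
  shows "cov_deriv h (\<lambda>y. f y *\<^sub>R X y) j i x = partial j f x * X x $ i + f x * cov_deriv h X j i x"
  using partial_mult [OF smooth_on_differentiable [OF assms(1,3)] differentiable_component [OF assms(2,3)]]
  by (simp add: cov_deriv_def sum_2 algebra_simps)

text \<open>The rotation is parallel because it is built from the metric and the area density, both
  preserved by the connection. In coordinates, the derivatives of \<open>h\<close> and of the
  reciprocal density account for all Christoffel terms.\<close>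

lemma cov_deriv_quarter_turn:
  assumes X: "smooth_on V X" and x: "x \<in> V"
  shows "cov_deriv h (\<lambda>y. quarter_turn (h y) (X y)) j i x =
    quarter_turn (h x) (\<chi> i. cov_deriv h X j i x) $ i"
proof -
  note d = differentiable_entry [OF x] differentiable_component [OF X x]
  have r: "sqrt (det (h x)) \<noteq> 0"
    using det_pos [OF x] by simp
  have inv: "(\<lambda>y. inverse (sqrt (det (h y)))) differentiable at x"
    using r smooth_on_differentiable [OF smooth_volume x] by (simp add: differentiable_inverse)
  have pinv: "partial j (\<lambda>y. inverse (sqrt (det (h y)))) x =
      - (christoffel h 1 j 1 x + christoffel h 2 j 2 x) * inverse (sqrt (det (h x)))"
  proof -
    \<comment> \<open>Here \<open>t\<close> is the density, \<open>s\<close> its reciprocal and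
      \<open>c\<close> the contracted Christoffel symbol, so the last factor \<open>s * t\<close> is
      1.\<close>
    have "- (s * (c * t) * s) = - c * s * (s * t)" for s c t :: real
      by simp
    then show ?thesis
      using partial_inverse [OF smooth_on_differentiable [OF smooth_volume x] r, of j]
      by (simp only: partial_volume [OF x] left_inverse [OF r] mult_1_right)
  qed
  show ?thesis
    using exhaust_2 [of i]
    by (elim disjE; simp add: cov_deriv_def quarter_turn_def sum_2 matrix_vector_mult_def
        partial_add partial_minus partial_mult differentiable_mult differentiable_minus differentiable_add
        d inv pinv partial_metric [OF x] h21 [OF x] del: minus_add_distrib; simp add: algebra_simps)
qed

lemma partial_inner:
  assumes X: "smooth_on V X" and x: "x \<in> V"
  shows "partial j (\<lambda>y. X y \<bullet> (h y *v X y)) x = 2 * (X x \<bullet> (h x *v (\<chi> i. cov_deriv h X j i x)))"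
proof -
  note d = differentiable_entry [OF x] differentiable_component [OF X x]
  show ?thesis
    by (simp add: inner_vec_def cov_deriv_def sum_2 matrix_vector_mult_def
        partial_add partial_mult differentiable_mult differentiable_add
        d partial_metric [OF x] h21 [OF x]) (simp add: algebra_simps)
qed

lemma gradient_inner:
  assumes "f differentiable at x" "x \<in> V"
  shows "v \<bullet> (h x *v gradient h f x) = frechet_derivative f (at x) v"
  by (rule gradient_characterization [where h = h and x = x, OF invertible_h [OF assms(2)] assms(1)])

lemma metric_norm_squared: "x \<in> V \<Longrightarrow> (metric_norm h x v)\<^sup>2 = v \<bullet> (h x *v v)"
  using positive [of x v] by (cases "v = 0") (auto simp: metric_norm_def)

lemma cov_deriv_cong:
  assumes "\<And>y. y \<in> V \<Longrightarrow> X y = Y y" "x \<in> V"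
  shows "cov_deriv h X j i x = cov_deriv h Y j i x"
  unfolding cov_deriv_def
  using partial_cong [OF open_V assms(2), of "\<lambda>y. X y $ i" "\<lambda>y. Y y $ i" j] assms by simp

lemma smooth_flux:
  assumes "smooth_on V u" and pos: "\<And>y. y \<in> V \<Longrightarrow> 0 < 1 + \<kappa> * (metric_norm h y (gradient h u y))\<^sup>2"
  shows "smooth_on V (flux \<kappa> h u)"
proof -
  have "smooth_on V (\<lambda>y. inverse (sqrt (1 + \<kappa> * (gradient h u y \<bullet> (h y *v gradient h u y)))) *\<^sub>R gradient h u y)"
  proof (intro smooth_scaleR smooth_on_inverse smooth_on_sqrt smooth_on_add smooth_on_mult smooth_on_const
      smooth_inner smooth_gradient assms(1) open_V)
    fix y assume y: "y \<in> V"
    show "0 < 1 + \<kappa> * (gradient h u y \<bullet> (h y *v gradient h u y))"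
      using pos [OF y] by (simp add: metric_norm_squared [OF y])
    then show "sqrt (1 + \<kappa> * (gradient h u y \<bullet> (h y *v gradient h u y))) \<noteq> 0"
      by simp
  qed
  then show ?thesis
    by (rule smooth_on_cong [OF open_V, rotated]) (simp add: flux_def metric_norm_squared)
qed

lemma smooth_conjugate_form:
  assumes "smooth_on V X"
  shows "smooth_on V (conjugate_form h X)"
  unfolding conjugate_form_def [abs_def]
proof (rule smooth_scaleR [OF smooth_volume smooth_on_vec [OF open_V]])
  fix i :: 2
  have c: "smooth_on V (\<lambda>y. X y $ j)" for j
    by (rule smooth_on_vec_nth [OF open_V assms])
  show "smooth_on V (\<lambda>y. (vector [- X y $ 2, X y $ 1] :: real^2) $ i)"
    using exhaust_2 [of i] c smooth_on_minus [OF open_V c] by auto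
qed

text \<open>The curl of the conjugate form is the density times the divergence of
  \<open>X\<close>.\<close>

lemma conjugate_form_closed:
  assumes X: "smooth_on V X" and x: "x \<in> V" and "divergence h X x = 0"
  shows "frechet_derivative (conjugate_form h X) (at x) v \<bullet> w =
    frechet_derivative (conjugate_form h X) (at x) w \<bullet> v"
proof (rule closed_form_symmetric)
  show "conjugate_form h X differentiable at x"
    by (rule smooth_on_differentiable [OF smooth_conjugate_form [OF X] x])
  have "(\<lambda>y. sqrt (det (h y)) * X y $ 2) differentiable at x"
    by (intro differentiable_mult smooth_on_differentiable [OF smooth_volume x] differentiable_component [OF X x])
  then have "partial 2 (\<lambda>y. conjugate_form h X y $ 1) x = - partial 2 (\<lambda>y. sqrt (det (h y)) * X y $ 2) x"
    using partial_minus by (simp add: conjugate_form_def)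
  then show "partial 1 (\<lambda>y. conjugate_form h X y $ 2) x = partial 2 (\<lambda>y. conjugate_form h X y $ 1) x"
    using volume_divergence [OF X x] assms(3) by (simp add: conjugate_form_def)
qed

lemma metric_quarter_turn_field: "y \<in> V \<Longrightarrow> h y *v quarter_turn (h y) (X y) = conjugate_form h X y"
  using metric_quarter_turn [OF h21 det_pos, of y "X y"] by (simp add: conjugate_form_def)

text \<open>A conjugate pair in one chart. The number \<epsilon> is 1 or -1 and compares the
  orientation that belongs to \<open>w\<close> with that of the coordinates.\<close>

context
  fixes \<kappa> \<epsilon> :: real and u w :: "real^2 \<Rightarrow> real"
  assumes u: "smooth_on V u"
    and pos: "\<And>y. y \<in> V \<Longrightarrow> 0 < 1 + \<kappa> * (metric_norm h y (gradient h u y))\<^sup>2"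
    and w: "\<And>y. y \<in> V \<Longrightarrow> (w has_derivative (\<lambda>v. \<epsilon> * (conjugate_form h (flux \<kappa> h u) y \<bullet> v))) (at y)"
    and \<epsilon>: "\<epsilon> * \<epsilon> = 1"
begin

lemma conjugate_smooth: "smooth_on V w"
proof (rule smooth_onI [OF open_V w])
  fix v
  have "smooth_on V (\<lambda>y. conjugate_form h (flux \<kappa> h u) y \<bullet> v)"
    by (rule smooth_on_linear [OF bounded_linear_inner_left open_V])
      (rule smooth_conjugate_form [OF smooth_flux [OF u pos]])
  then show "smooth_on V (\<lambda>y. \<epsilon> * (conjugate_form h (flux \<kappa> h u) y \<bullet> v))"
    by (rule smooth_on_mult [OF open_V smooth_on_const])
qed

lemma conjugate_gradient:
  assumes y: "y \<in> V"
  shows "gradient h w y = \<epsilon> *\<^sub>R quarter_turn (h y) (flux \<kappa> h u y)"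
proof -
  have "(\<chi> j. partial j w y) = \<epsilon> *\<^sub>R conjugate_form h (flux \<kappa> h u) y"
    using partial_eqI [OF w [OF y]] by (simp add: vec_eq_iff inner_axis)
  also have "\<dots> = h y *v (\<epsilon> *\<^sub>R quarter_turn (h y) (flux \<kappa> h u y))"
    by (simp add: matrix_vector_mult_scaleR metric_quarter_turn_field [OF y])
  finally show ?thesis
    by (simp only: gradient_def matrix_inv_mult [OF y])
qed

text \<open>Since \<open>quarter_turn\<close> is an isometry, \<open>|Dw|^2\<close> equals
  \<open>N / (1 + \<kappa> * N)\<close> for \<open>N = |Du|^2\<close>. Positivity of the right side
  yields the constraint \<open>|Dw|^2 < 1\<close> when \<kappa> is 1.\<close>

lemma conjugate_norm:
  assumes y: "y \<in> V"
  shows "1 + - \<kappa> * (metric_norm h y (gradient h w y))\<^sup>2 = inverse (1 + \<kappa> * (metric_norm h y (gradient h u y))\<^sup>2)"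
proof -
  let ?X = "flux \<kappa> h u y" and ?N = "(metric_norm h y (gradient h u y))\<^sup>2"
  let ?s = "sqrt (1 + \<kappa> * ?N)"
  have "(metric_norm h y (gradient h w y))\<^sup>2 = (\<epsilon> * \<epsilon>) * (quarter_turn (h y) ?X \<bullet> (h y *v quarter_turn (h y) ?X))"
    by (simp add: metric_norm_squared [OF y] conjugate_gradient [OF y] matrix_vector_mult_scaleR)
  also have "\<dots> = ?X \<bullet> (h y *v ?X)"
    using inner_quarter_turn [OF h21 [OF y] det_pos [OF y]] \<epsilon> by simp
  also have "\<dots> = inverse ?s * inverse ?s * ?N"
    by (simp add: flux_def metric_norm_squared [OF y] matrix_vector_mult_scaleR)
  also have "inverse ?s * inverse ?s = inverse (?s * ?s)"
    by (simp only: inverse_mult_distrib)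
  also have "?s * ?s = 1 + \<kappa> * ?N"
    using pos [OF y] by simp
  finally show ?thesis
    using pos [OF y] by (simp add: field_simps)
qed

lemma conjugate_pos: "y \<in> V \<Longrightarrow> 0 < 1 + - \<kappa> * (metric_norm h y (gradient h w y))\<^sup>2"
  unfolding conjugate_norm using pos by simp

text \<open>By \<open>conjugate_norm\<close>, normalising \<open>Dw\<close> for -\<kappa> undoes the
  normalisation of \<open>Du\<close> for \<kappa>, which leaves the turned gradient.\<close>

lemma conjugate_flux:
  assumes y: "y \<in> V"
  shows "flux (- \<kappa>) h w y = \<epsilon> *\<^sub>R quarter_turn (h y) (gradient h u y)"
proof -
  let ?s = "sqrt (1 + \<kappa> * (metric_norm h y (gradient h u y))\<^sup>2)"
  have s: "?s \<noteq> 0"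
    using pos [OF y] by simp
  have "flux (- \<kappa>) h w y = ?s *\<^sub>R gradient h w y"
    unfolding flux_def conjugate_norm [OF y] by (simp add: real_sqrt_inverse)
  also have "\<dots> = (?s * inverse ?s) *\<^sub>R \<epsilon> *\<^sub>R quarter_turn (h y) (gradient h u y)"
    unfolding conjugate_gradient [OF y] flux_def quarter_turn_scaleR by (simp add: mult_ac)
  finally show ?thesis
    using s by simp
qed

text \<open>The density cancels against its reciprocal in the turned gradient, so
  \<open>volume_divergence\<close> leaves the two mixed second derivatives of \<open>u\<close> with
  opposite signs.\<close>

lemma conjugate_divergence:
  assumes x: "x \<in> V"
  shows "divergence h (flux (- \<kappa>) h w) x = 0"
proof -
  have h_grad: "h y *v gradient h u y = (\<chi> j. partial j u y)" if "y \<in> V" for y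
    by (simp add: gradient_def matrix_inv_mult that)
  have c: "sqrt (det (h y)) * flux (- \<kappa>) h w y $ 1 = - \<epsilon> * partial 2 u y"
    "sqrt (det (h y)) * flux (- \<kappa>) h w y $ 2 = \<epsilon> * partial 1 u y" if y: "y \<in> V" for y
    using det_pos [OF y] by (simp_all add: conjugate_flux [OF y] quarter_turn_def h_grad [OF y])
  have d: "partial i u differentiable at x" for i
    by (rule smooth_on_differentiable [OF smooth_on_partial [OF u] x])
  have "sqrt (det (h x)) * divergence h (flux (- \<kappa>) h w) x =
      partial 1 (\<lambda>y. - \<epsilon> * partial 2 u y) x + partial 2 (\<lambda>y. \<epsilon> * partial 1 u y) x"
    using volume_divergence [OF smooth_flux [OF conjugate_smooth conjugate_pos] x]
      partial_cong [OF open_V x c(1)] partial_cong [OF open_V x c(2)] by simp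
  also have "\<dots> = - \<epsilon> * partial 1 (partial 2 u) x + \<epsilon> * partial 2 (partial 1 u) x"
    by (simp only: partial_cmult d)
  also have "\<dots> = 0"
    by (simp add: partial_partial_commute [OF u open_V x, of 1 2])
  finally show ?thesis
    using det_pos [OF x] by simp
qed

text \<open>The argument works at the single point \<open>x\<close>: a vanishing covariant
  derivative of \<open>Dw\<close> there makes the derivative of \<open>|Dw|^2\<close>, hence that of
  the factor \<open>f\<close>, vanish there. The product rule for
  \<open>Du = - \<epsilon> f J Dw\<close> then has only zero terms.\<close>

lemma conjugate_parallel:
  assumes x: "x \<in> V" and parallel: "\<And>i j. cov_deriv h (gradient h w) j i x = 0"
  shows "cov_deriv h (gradient h u) j i x = 0"
proof -
  let ?W = "gradient h w"
  define f where "f y = inverse (sqrt (1 + - \<kappa> * (?W y \<bullet> (h y *v ?W y))))" for y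
  have W: "smooth_on V ?W"
    by (rule smooth_gradient [OF conjugate_smooth])
  have p: "0 < 1 + - \<kappa> * (?W y \<bullet> (h y *v ?W y))" if "y \<in> V" for y
    using conjugate_pos [OF that] by (simp add: metric_norm_squared [OF that])
  have N: "smooth_on V (\<lambda>y. ?W y \<bullet> (h y *v ?W y))"
    by (rule smooth_inner [OF W])
  have sq: "smooth_on V (\<lambda>y. sqrt (1 + - \<kappa> * (?W y \<bullet> (h y *v ?W y))))"
    by (intro smooth_on_sqrt smooth_on_add smooth_on_mult smooth_on_const N open_V p)
  have f: "smooth_on V f"
    unfolding f_def using p by (intro smooth_on_inverse sq open_V) force
  have grad: "gradient h u y = f y *\<^sub>R (- \<epsilon>) *\<^sub>R quarter_turn (h y) (?W y)" if y: "y \<in> V" for y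
  proof -
    \<comment> \<open>A second quarter turn of \<open>conjugate_flux\<close> recovers
      \<open>gradient h u y\<close> up to the sign \<epsilon> and the square -1 of the
      rotation.\<close>
    have "quarter_turn (h y) (flux (- \<kappa>) h w y) = \<epsilon> *\<^sub>R - gradient h u y"
      unfolding conjugate_flux [OF y] quarter_turn_scaleR
        quarter_turn_quarter_turn [OF h21 [OF y] det_pos [OF y]] ..
    then have "(- \<epsilon>) *\<^sub>R quarter_turn (h y) (flux (- \<kappa>) h w y) = (\<epsilon> * \<epsilon>) *\<^sub>R gradient h u y"
      by simp
    then have "gradient h u y = (- \<epsilon>) *\<^sub>R quarter_turn (h y) (flux (- \<kappa>) h w y)"
      by (simp add: \<epsilon>)
    also have "\<dots> = f y *\<^sub>R (- \<epsilon>) *\<^sub>R quarter_turn (h y) (?W y)"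
      by (simp add: flux_def quarter_turn_scaleR f_def metric_norm_squared [OF y] mult_ac)
    finally show ?thesis .
  qed
  have zero: "(\<chi> i. cov_deriv h ?W j i x) = 0" for j
    by (simp add: parallel vec_eq_iff)
  have "partial j (\<lambda>y. 1 + - \<kappa> * (?W y \<bullet> (h y *v ?W y))) x = 0"
    using smooth_on_differentiable [OF N x]
    by (simp only: partial_add partial_const partial_cmult partial_inner [OF W x] zero differentiable_const
        differentiable_mult) simp
  then have "partial j (\<lambda>y. sqrt (1 + - \<kappa> * (?W y \<bullet> (h y *v ?W y)))) x = 0"
    using partial_sqrt [where f = "\<lambda>y. 1 + - \<kappa> * (?W y \<bullet> (h y *v ?W y))" and x = x, OF _ p [OF x], of j]
      smooth_on_differentiable [OF N x]
    by (simp add: differentiable_add differentiable_mult)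
  then have pf: "partial j f x = 0"
    unfolding f_def using partial_inverse [OF smooth_on_differentiable [OF sq x], of j] p [OF x] by simp
  have J: "smooth_on V (\<lambda>y. quarter_turn (h y) (?W y))"
    by (rule smooth_quarter_turn [OF W])
  have "cov_deriv h (gradient h u) j i x =
      cov_deriv h (\<lambda>y. f y *\<^sub>R (- \<epsilon>) *\<^sub>R quarter_turn (h y) (?W y)) j i x"
    by (rule cov_deriv_cong [OF grad x])
  also have "\<dots> = 0"
    by (simp only: cov_deriv_scaleR f J smooth_scaleR smooth_on_const x pf partial_const
        cov_deriv_quarter_turn [OF W x] zero quarter_turn_zero) simp
  finally show ?thesis .
qed

end

end

section \<open>Charts and conjugate solutions\<close>

text \<open>Serves for the glued function \<open>w\<close>, which is recognised as smooth only near
  each point, as a local primitive there.\<close>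

lemma smooth_on_local:
  assumes "\<And>x. x \<in> S \<Longrightarrow> \<exists>V. open V \<and> x \<in> V \<and> smooth_on V f"
  shows "smooth_on S f"
  unfolding smooth_on_def
proof
  have Ck: "Ck_on k S f" if "\<And>x. x \<in> S \<Longrightarrow> \<exists>V. open V \<and> x \<in> V \<and> Ck_on k V f" for k
    using that
  proof (induction k arbitrary: f)
    case 0
    have "isCont f x" if "x \<in> S" for x
      using 0 [OF that] continuous_on_eq_continuous_at by (metis Ck_on.simps(1))
    then show ?case
      by (simp add: continuous_at_imp_continuous_on)
  next
    case (Suc k)
    have "f differentiable at x" if "x \<in> S" for x
      using Suc.prems [OF that] by auto
    moreover have "Ck_on k S (\<lambda>x. frechet_derivative f (at x) v)" for v
    proof (rule Suc.IH)
      fix x assume "x \<in> S"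
      then show "\<exists>V. open V \<and> x \<in> V \<and> Ck_on k V (\<lambda>x. frechet_derivative f (at x) v)"
        using Suc.prems [of x] unfolding Ck_on.simps by blast
    qed
    ultimately show ?case
      by simp
  qed
  fix k
  show "Ck_on k S f"
    using assms by (intro Ck) (auto simp: smooth_on_def)
qed

text \<open>The positivity clause is the constraint \<open>|Dw|^2 < 1\<close> for \<kappa> = -1 and
  holds for every function when \<kappa> = 1, so that both equations become instances.\<close>

definition solution ::
  "real \<Rightarrow> 'a chart set \<Rightarrow> ('a chart \<Rightarrow> real^2 \<Rightarrow> real^2^2) \<Rightarrow> 'a set \<Rightarrow> ('a \<Rightarrow> real) \<Rightarrow> bool" where
  "solution \<kappa> A g \<Omega> u \<longleftrightarrow> smooth_fun A \<Omega> u \<and>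
    (\<forall>c\<in>A. \<forall>x\<in>chart_map c ` (chart_dom c \<inter> \<Omega>).
      0 < 1 + \<kappa> * (metric_norm (g c) x (gradient (g c) (u \<circ> chart_inv c) x))\<^sup>2 \<and>
      divergence (g c) (flux \<kappa> (g c) (u \<circ> chart_inv c)) x = 0)"

lemma minimal_iff_solution:
  "smooth_fun A \<Omega> u \<and> minimal_surface_eq A g \<Omega> u \<longleftrightarrow> solution 1 A g \<Omega> u"
proof -
  have "0 < 1 + t\<^sup>2" for t :: real
    by (simp add: add_pos_nonneg)
  then show ?thesis
    by (simp add: solution_def minimal_surface_eq_def flux_def [abs_def] Let_def)
qed

lemma maximal_iff_solution:
  "smooth_fun A \<Omega> w \<and> maximal_surface_eq A g \<Omega> w \<longleftrightarrow> solution (- 1) A g \<Omega> w"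
  by (auto simp: solution_def maximal_surface_eq_def flux_def [abs_def] Let_def)

definition jacobian :: "'a chart \<Rightarrow> 'a chart \<Rightarrow> 'a \<Rightarrow> real^2^2" where
  "jacobian c d p = matrix (frechet_derivative (chart_map d \<circ> chart_inv c) (at (chart_map c p)))"

definition orientation_sign :: "'a chart \<Rightarrow> 'a chart \<Rightarrow> 'a \<Rightarrow> real" where
  "orientation_sign c d p = sgn (det (jacobian c d p))"

locale surface_domain = riemannian_surface M A g
  for M :: "'a::{t2_space,second_countable_topology} set" and A g +
  fixes \<Omega> :: "'a set"
  assumes open_\<Omega>: "openin (top_of_set M) \<Omega>"
begin

section \<open>Charts and open sets\<close>

lemma inv_chart:
  assumes "c \<in> A" "p \<in> chart_dom c"
  shows "chart_inv c (chart_map c p) = p"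
  using chart_homeomorphism [OF assms(1)] assms(2) by (simp add: homeomorphism_def)

lemma chart_inv:
  assumes "c \<in> A" "x \<in> chart_map c ` chart_dom c"
  shows "chart_map c (chart_inv c x) = x" "chart_inv c x \<in> chart_dom c"
  using chart_homeomorphism [OF assms(1)] assms(2) by (auto simp: homeomorphism_def)

lemma openin_M:
  assumes "openin (top_of_set \<Omega>) U"
  shows "openin (top_of_set M) U"
  using assms open_\<Omega> openin_trans by blast

lemma open_chart_image:
  assumes c: "c \<in> A" and U: "openin (top_of_set M) U"
  shows "open (chart_map c ` (chart_dom c \<inter> U))"
proof -
  have "chart_dom c \<subseteq> M"
    using dom_open [OF c] openin_imp_subset by blast
  then have "openin (top_of_set (chart_dom c)) (chart_dom c \<inter> U)"
    using U by (auto simp: openin_open)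
  then have "openin (top_of_set (chart_map c ` chart_dom c)) (chart_map c ` (chart_dom c \<inter> U))"
    using homeomorphism_imp_open_map [OF chart_homeomorphism [OF c]] by blast
  then show ?thesis
    using image_open [OF c] openin_open_trans by blast
qed

lemma openin_chart_vimage:
  assumes c: "c \<in> A" and W: "open W"
  shows "openin (top_of_set \<Omega>) {q \<in> \<Omega> \<inter> chart_dom c. chart_map c q \<in> W}"
proof -
  have "continuous_on (chart_dom c) (chart_map c)"
    using chart_homeomorphism [OF c] by (simp add: homeomorphism_def)
  then have "openin (top_of_set (chart_dom c)) (chart_dom c \<inter> chart_map c -` W)"
    using W by (rule continuous_openin_preimage_gen)
  then have "openin (top_of_set M) (chart_dom c \<inter> chart_map c -` W)"
    using dom_open [OF c] openin_trans by blast
  then obtain T where "open T" "chart_dom c \<inter> chart_map c -` W = M \<inter> T"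
    by (auto simp: openin_open)
  moreover have "\<Omega> \<subseteq> M"
    using open_\<Omega> openin_imp_subset by blast
  ultimately have "{q \<in> \<Omega> \<inter> chart_dom c. chart_map c q \<in> W} = \<Omega> \<inter> T"
    by auto
  then show ?thesis
    using \<open>open T\<close> by (auto simp: openin_open)
qed

lemma metric_patch_subset:
  assumes "c \<in> A" "open V" "V \<subseteq> chart_map c ` chart_dom c"
  shows "metric_patch V (g c)"
  using assms metric_smooth metric_symmetric metric_positive smooth_on_subset
  by unfold_locales blast+

lemma metric_patch_chart: "c \<in> A \<Longrightarrow> metric_patch (chart_map c ` chart_dom c) (g c)"
  using metric_patch_subset image_open by blast

lemma open_overlap:
  assumes "c \<in> A" "d \<in> A"
  shows "open (chart_map c ` (chart_dom c \<inter> chart_dom d))"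
  using open_chart_image [OF assms(1) dom_open [OF assms(2)]] .

section \<open>Behaviour under a change of charts\<close>

lemma transition_has_derivative:
  assumes "c \<in> A" "d \<in> A" "p \<in> chart_dom c" "p \<in> chart_dom d"
  shows "(chart_map d \<circ> chart_inv c has_derivative (\<lambda>v. jacobian c d p *v v)) (at (chart_map c p))"
proof -
  have "(chart_map d \<circ> chart_inv c has_derivative
      frechet_derivative (chart_map d \<circ> chart_inv c) (at (chart_map c p))) (at (chart_map c p))"
    using assms by (intro smooth_on_has_derivative [OF transition_smooth]) auto
  moreover from this have "linear (frechet_derivative (chart_map d \<circ> chart_inv c) (at (chart_map c p)))"
    by (rule has_derivative_linear)
  ultimately show ?thesis
    by (simp add: jacobian_def matrix_works)
qed

context
  fixes c d p
  assumes c: "c \<in> A" "p \<in> chart_dom c" and d: "d \<in> A" "p \<in> chart_dom d"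
begin

interpretation C: metric_patch "chart_map c ` chart_dom c" "g c"
  by (rule metric_patch_chart [OF c(1)])

interpretation D: metric_patch "chart_map d ` chart_dom d" "g d"
  by (rule metric_patch_chart [OF d(1)])

lemma metric_jacobian:
  "g c (chart_map c p) = transpose (jacobian c d p) ** g d (chart_map d p) ** jacobian c d p"
  using metric_transformation [OF c(1) d(1) _ refl, of p] c d by (simp add: jacobian_def)

lemma det_metric: "det (g c (chart_map c p)) = (det (jacobian c d p))\<^sup>2 * det (g d (chart_map d p))"
  unfolding metric_jacobian by (simp add: det_mul power2_eq_square)

lemma det_jacobian: "det (jacobian c d p) \<noteq> 0"
  using C.det_pos [of "chart_map c p"] c det_metric by auto

lemma sqrt_det_metric:
  "sqrt (det (g c (chart_map c p))) = \<bar>det (jacobian c d p)\<bar> * sqrt (det (g d (chart_map d p)))"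
  unfolding det_metric by (simp add: real_sqrt_mult)

lemma inner_jacobian:
  "v \<bullet> (g c (chart_map c p) *v w) =
    (jacobian c d p *v v) \<bullet> (g d (chart_map d p) *v (jacobian c d p *v w))"
  unfolding metric_jacobian matrix_vector_mul_assoc [symmetric]
  by (simp add: dot_lmul_matrix [symmetric] flip: transpose_matrix_vector)

text \<open>By the chain rule both sides have the same inner product with every vector
  \<open>?J *v v\<close>. As \<open>?J\<close> is onto, their difference \<open>y\<close> is
  orthogonal to itself.\<close>

lemma gradient_jacobian:
  assumes u: "smooth_fun A \<Omega> u" and p: "p \<in> \<Omega>"
  shows "gradient (g d) (u \<circ> chart_inv d) (chart_map d p) =
    jacobian c d p *v gradient (g c) (u \<circ> chart_inv c) (chart_map c p)"
proof -
  let ?J = "jacobian c d p" and ?uc = "u \<circ> chart_inv c" and ?ud = "u \<circ> chart_inv d"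
  let ?Xc = "gradient (g c) ?uc (chart_map c p)" and ?Xd = "gradient (g d) ?ud (chart_map d p)"
  have uc: "?uc differentiable at (chart_map c p)" and ud: "?ud differentiable at (chart_map d p)"
    using u p c d by (auto simp: smooth_fun_def intro!: smooth_on_differentiable)
  have "(?ud has_derivative frechet_derivative ?ud (at (chart_map d p)))
      (at ((chart_map d \<circ> chart_inv c) (chart_map c p)))"
    using ud by (simp add: inv_chart c differentiable_has_derivative)
  from diff_chain_at [OF transition_has_derivative [OF c(1) d(1) c(2) d(2)] this]
  have "(?ud \<circ> (chart_map d \<circ> chart_inv c) has_derivative
      frechet_derivative ?ud (at (chart_map d p)) \<circ> (\<lambda>v. ?J *v v)) (at (chart_map c p))" .
  moreover have "(?ud \<circ> (chart_map d \<circ> chart_inv c)) x = ?uc x"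
    if "x \<in> chart_map c ` (chart_dom c \<inter> chart_dom d)" for x
    using that c(1) d(1) by (auto simp: inv_chart)
  moreover have "chart_map c p \<in> chart_map c ` (chart_dom c \<inter> chart_dom d)"
    using c d by blast
  ultimately have "(?uc has_derivative
      frechet_derivative ?ud (at (chart_map d p)) \<circ> (\<lambda>v. ?J *v v)) (at (chart_map c p))"
    using has_derivative_transform_within_open [OF _ open_overlap [OF c(1) d(1)]] by blast
  then have fd: "frechet_derivative ?uc (at (chart_map c p)) v =
      frechet_derivative ?ud (at (chart_map d p)) (?J *v v)" for v
    using frechet_derivative_at by (metis comp_apply)
  define y where "y = ?J *v ?Xc - ?Xd"
  have "(?J *v v) \<bullet> (g d (chart_map d p) *v (?J *v ?Xc)) = (?J *v v) \<bullet> (g d (chart_map d p) *v ?Xd)" for v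
    using C.gradient_inner [OF uc, of v] D.gradient_inner [OF ud, of "?J *v v"] c d fd inner_jacobian
    by simp
  then have zero: "(?J *v v) \<bullet> (g d (chart_map d p) *v y) = 0" for v
    by (simp add: y_def matrix_vector_mult_diff_distrib inner_diff_right)
  have "?J *v (matrix_inv ?J *v y) = y"
    using det_jacobian matrix_inv_inverse(1) [of ?J]
    by (simp add: matrix_vector_mul_assoc invertible_det_nz)
  then have "y \<bullet> (g d (chart_map d p) *v y) = 0"
    using zero by metis
  then have "y = 0"
    using D.positive [of "chart_map d p" y] d by fastforce
  then show ?thesis
    by (simp add: y_def)
qed

lemma flux_jacobian:
  assumes u: "smooth_fun A \<Omega> u" and p: "p \<in> \<Omega>"
  shows "flux \<kappa> (g d) (u \<circ> chart_inv d) (chart_map d p) =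
    jacobian c d p *v flux \<kappa> (g c) (u \<circ> chart_inv c) (chart_map c p)"
  using c d by (simp add: flux_def gradient_jacobian [OF assms] matrix_vector_mult_scaleR
      C.metric_norm_squared D.metric_norm_squared inner_jacobian)

text \<open>Coordinate area scales with the determinant of the Jacobian, the density with its
  absolute value; the sign is what remains. It is the only obstacle to gluing the conjugate forms of
  different charts.\<close>

lemma conjugate_form_jacobian:
  assumes "Xd (chart_map d p) = jacobian c d p *v Xc (chart_map c p)"
  shows "conjugate_form (g d) Xd (chart_map d p) \<bullet> (jacobian c d p *v v) =
    orientation_sign c d p * (conjugate_form (g c) Xc (chart_map c p) \<bullet> v)"
proof -
  let ?J = "jacobian c d p"
  have area: "vector [- (?J *v X) $ 2, (?J *v X) $ 1] \<bullet> (?J *v v) =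
      det ?J * (vector [- X $ 2, X $ 1] \<bullet> v)" for X :: "real^2"
    by (simp add: coord2) (simp add: algebra_simps)
  have "conjugate_form (g d) Xd (chart_map d p) \<bullet> (?J *v v) =
      sqrt (det (g d (chart_map d p))) * (det ?J * (vector [- Xc (chart_map c p) $ 2, Xc (chart_map c p) $ 1] \<bullet> v))"
    by (simp add: conjugate_form_def assms area)
  also have "det ?J = orientation_sign c d p * \<bar>det ?J\<bar>"
    by (simp add: orientation_sign_def sgn_mult_abs)
  finally show ?thesis
    by (simp add: conjugate_form_def sqrt_det_metric mult.assoc)
qed

lemma orientation_sign_values: "orientation_sign c d p \<in> {1, - 1}"
  using det_jacobian by (auto simp: orientation_sign_def sgn_if)

text \<open>The Jacobian determinant is continuous and nonzero on the overlap; \<open>W\<close>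
  collects the points where it has the same sign as at \<open>p\<close>.\<close>

lemma orientation_sign_locally_constant:
  assumes "p \<in> \<Omega>"
  obtains W where "openin (top_of_set \<Omega>) W" "p \<in> W" "W \<subseteq> chart_dom c \<inter> chart_dom d"
    "\<And>q. q \<in> W \<Longrightarrow> orientation_sign c d q = orientation_sign c d p"
proof -
  let ?O = "chart_map c ` (chart_dom c \<inter> chart_dom d)"
  let ?f = "\<lambda>x. det (matrix (frechet_derivative (chart_map d \<circ> chart_inv c) (at x))) * orientation_sign c d p"
  have entry: "continuous_on ?O (\<lambda>x. matrix (frechet_derivative (chart_map d \<circ> chart_inv c) (at x)) $ i $ j)" for i j
    unfolding matrix_def vec_lambda_beta
    by (intro smooth_on_continuous smooth_on_vec_nth smooth_on_frechet_derivative transition_smooth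
        open_overlap c(1) d(1))
  then have "continuous_on ?O ?f"
    unfolding det_2
    by (intro continuous_on_diff continuous_on_mult continuous_on_const entry)
  then have op: "open (?O \<inter> ?f -` {0<..})"
    by (intro continuous_open_preimage open_overlap c(1) d(1)) auto
  let ?W = "{q \<in> \<Omega> \<inter> chart_dom c. chart_map c q \<in> ?O \<inter> ?f -` {0<..}}"
  have f: "?f (chart_map c q) = det (jacobian c d q) * orientation_sign c d p" for q
    by (simp add: jacobian_def)
  show ?thesis
  proof (rule that [of ?W])
    show "openin (top_of_set \<Omega>) ?W"
      by (rule openin_chart_vimage [OF c(1) op])
    have "0 < det (jacobian c d p) * orientation_sign c d p"
      using det_jacobian by (simp add: orientation_sign_def sgn_if)
    then have "0 < ?f (chart_map c p)"
      by (simp only: f)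
    then show "p \<in> ?W"
      using assms c d by simp
    show "?W \<subseteq> chart_dom c \<inter> chart_dom d"
    proof
      fix q assume q: "q \<in> ?W"
      then obtain q' where "q' \<in> chart_dom c \<inter> chart_dom d" "chart_map c q = chart_map c q'"
        by auto
      then show "q \<in> chart_dom c \<inter> chart_dom d"
        using q inv_chart [OF c(1)] by (metis (no_types, lifting) IntD1 mem_Collect_eq IntD2 IntI)
    qed
    fix q assume "q \<in> ?W"
    then have "0 < ?f (chart_map c q)"
      by blast
    then have "0 < det (jacobian c d q) * orientation_sign c d p"
      by (simp only: f)
    then show "orientation_sign c d q = orientation_sign c d p"
      unfolding orientation_sign_def [of c d q] using orientation_sign_values
      by (auto simp: sgn_if zero_less_mult_iff)
  qed
qed

end

lemma orientation_sign_cocycle: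
  assumes "c \<in> A" "d \<in> A" "e \<in> A" "p \<in> chart_dom c" "p \<in> chart_dom d" "p \<in> chart_dom e"
  shows "orientation_sign c e p = orientation_sign c d p * orientation_sign d e p"
proof -
  have "(chart_map e \<circ> chart_inv d has_derivative (\<lambda>v. jacobian d e p *v v))
      (at ((chart_map d \<circ> chart_inv c) (chart_map c p)))"
    using transition_has_derivative [of d e p] assms by (simp add: inv_chart)
  from diff_chain_at [OF transition_has_derivative [of c d p] this] assms
  have "((chart_map e \<circ> chart_inv d) \<circ> (chart_map d \<circ> chart_inv c) has_derivative
      (\<lambda>v. (jacobian d e p ** jacobian c d p) *v v)) (at (chart_map c p))"
    by (simp add: o_def matrix_vector_mul_assoc)
  moreover have "((chart_map e \<circ> chart_inv d) \<circ> (chart_map d \<circ> chart_inv c)) x =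
      (chart_map e \<circ> chart_inv c) x"
    if "x \<in> chart_map c ` (chart_dom c \<inter> chart_dom d)" for x
    using that assms by (auto simp: inv_chart)
  moreover have "chart_map c p \<in> chart_map c ` (chart_dom c \<inter> chart_dom d)"
    using assms by blast
  ultimately have "(chart_map e \<circ> chart_inv c has_derivative
      (\<lambda>v. (jacobian d e p ** jacobian c d p) *v v)) (at (chart_map c p))"
    using has_derivative_transform_within_open [OF _ open_overlap [OF assms(1,2)]] by blast
  then have "(\<lambda>v. jacobian c e p *v v) = (\<lambda>v. (jacobian d e p ** jacobian c d p) *v v)"
    using has_derivative_unique transition_has_derivative [of c e p] assms by blast
  then have "jacobian c e p = jacobian d e p ** jacobian c d p"
    by (simp add: matrix_eq fun_eq_iff)
  then show ?thesis
    by (simp add: orientation_sign_def det_mul sgn_mult mult.commute)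
qed

text \<open>The cocycle identity for \<open>c\<close>, \<open>c\<close>, \<open>c\<close> forces the
  sign of \<open>c\<close> against itself to be 1, so the two signs in question have product
  1.\<close>

lemma orientation_sign_inverse:
  assumes "c \<in> A" "d \<in> A" "p \<in> chart_dom c" "p \<in> chart_dom d"
  shows "orientation_sign d c p = orientation_sign c d p"
proof -
  have "orientation_sign c c p = orientation_sign c c p * orientation_sign c c p"
    "orientation_sign c c p = orientation_sign c d p * orientation_sign d c p"
    using orientation_sign_cocycle assms by blast+
  then show ?thesis
    using orientation_sign_values [OF assms(1,3,1,3)] orientation_sign_values [OF assms(1,3,2,4)] by auto
qed

text \<open>An arbitrary reference chart at each point, chosen without any continuity. It allows an
  orientation at a point to be stored as 1 or -1, so that all fibres are the same set; locally
  constant are only the products with \<open>orientation_sign (home_chart q) c q\<close>.\<close>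

definition home_chart :: "'a \<Rightarrow> 'a chart" where
  "home_chart p = (SOME c. c \<in> A \<and> p \<in> chart_dom c)"

lemma home_chart:
  assumes "p \<in> \<Omega>"
  shows "home_chart p \<in> A" "p \<in> chart_dom (home_chart p)"
proof -
  have "\<exists>c. c \<in> A \<and> p \<in> chart_dom c"
    using assms covers openin_imp_subset [OF open_\<Omega>] by blast
  from someI_ex [OF this] show "home_chart p \<in> A" "p \<in> chart_dom (home_chart p)"
    by (simp_all add: home_chart_def)
qed

text \<open>The first component of a section is a local orientation of \<open>\<Omega>\<close>, recorded relative to the chart
  \<open>home_chart\<close>; the second component is a primitive of the correspondingly oriented conjugate form of the
  flux of \<open>u\<close>. Carrying both along at once avoids having to orient \<open>\<Omega>\<close> first.\<close>

definition conjugate_section :: "real \<Rightarrow> ('a \<Rightarrow> real) \<Rightarrow> 'a set \<Rightarrow> ('a \<Rightarrow> real \<times> real) \<Rightarrow> bool" where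
  "conjugate_section \<kappa> u U s \<longleftrightarrow> openin (top_of_set \<Omega>) U \<and> (\<forall>p\<in>U. fst (s p) \<in> {1, - 1}) \<and>
    (\<forall>p\<in>U. \<forall>c\<in>A. p \<in> chart_dom c \<longrightarrow> (\<exists>W \<epsilon>. openin (top_of_set \<Omega>) W \<and> p \<in> W \<and> W \<subseteq> U \<inter> chart_dom c \<and>
      (\<forall>q\<in>W. fst (s q) * orientation_sign (home_chart q) c q = \<epsilon> \<and>
        (snd \<circ> s \<circ> chart_inv c has_derivative
          (\<lambda>v. \<epsilon> * (conjugate_form (g c) (flux \<kappa> (g c) (u \<circ> chart_inv c)) (chart_map c q) \<bullet> v)))
        (at (chart_map c q)))))"

text \<open>Coordinate balls are the neighbourhoods of choice because they are convex: on them
  closed forms have primitives, and functions with zero derivative are constant.\<close>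

lemma chart_ball:
  assumes c: "c \<in> A" "p \<in> chart_dom c" and W: "openin (top_of_set \<Omega>) W" "p \<in> W"
  obtains r where "0 < r" "ball (chart_map c p) r \<subseteq> chart_map c ` (chart_dom c \<inter> W)"
    "openin (top_of_set \<Omega>) (chart_inv c ` ball (chart_map c p) r)" "p \<in> chart_inv c ` ball (chart_map c p) r"
    "chart_inv c ` ball (chart_map c p) r \<subseteq> W \<inter> chart_dom c"
proof -
  have "open (chart_map c ` (chart_dom c \<inter> W))"
    by (rule open_chart_image [OF c(1) openin_M [OF W(1)]])
  moreover have "chart_map c p \<in> chart_map c ` (chart_dom c \<inter> W)"
    using c W by blast
  ultimately obtain r where r: "0 < r" "ball (chart_map c p) r \<subseteq> chart_map c ` (chart_dom c \<inter> W)"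
    using openE by blast
  let ?B = "ball (chart_map c p) r"
  have sub: "chart_inv c ` ?B \<subseteq> W \<inter> chart_dom c"
    using r(2) inv_chart [OF c(1)] by force
  have eq: "chart_inv c ` ?B = {q \<in> \<Omega> \<inter> chart_dom c. chart_map c q \<in> ?B}"
  proof (intro equalityI subsetI)
    fix q assume q: "q \<in> chart_inv c ` ?B"
    then obtain x where x: "x \<in> ?B" "q = chart_inv c x"
      by blast
    then have "chart_map c q = x"
      using r(2) chart_inv(1) [OF c(1), of x] by blast
    moreover have "q \<in> \<Omega> \<inter> chart_dom c"
      using q sub openin_imp_subset [OF W(1)] by blast
    ultimately show "q \<in> {q \<in> \<Omega> \<inter> chart_dom c. chart_map c q \<in> ?B}"
      using x by blast
  next
    fix q assume "q \<in> {q \<in> \<Omega> \<inter> chart_dom c. chart_map c q \<in> ?B}"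
    then show "q \<in> chart_inv c ` ?B"
      using inv_chart [OF c(1)] by (metis (no_types, lifting) IntD2 imageI mem_Collect_eq)
  qed
  show ?thesis
  proof (rule that [OF r _ _ sub])
    show "openin (top_of_set \<Omega>) (chart_inv c ` ?B)"
      unfolding eq by (rule openin_chart_vimage [OF c(1) open_ball])
    show "p \<in> chart_inv c ` ?B"
      using r(1) inv_chart [OF c] by (metis centre_in_ball imageI)
  qed
qed

section \<open>The conjugate sections form a local system with a global section\<close>

context
  fixes \<kappa> :: real and u :: "'a \<Rightarrow> real"
  assumes sol: "solution \<kappa> A g \<Omega> u"
begin

abbreviation "form c \<equiv> conjugate_form (g c) (flux \<kappa> (g c) (u \<circ> chart_inv c))"

lemma solution_on_chart:
  assumes c: "c \<in> A" and V: "V \<subseteq> chart_map c ` (chart_dom c \<inter> \<Omega>)"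
  shows "smooth_on V (u \<circ> chart_inv c)"
    and "y \<in> V \<Longrightarrow> 0 < 1 + \<kappa> * (metric_norm (g c) y (gradient (g c) (u \<circ> chart_inv c) y))\<^sup>2"
    and "y \<in> V \<Longrightarrow> divergence (g c) (flux \<kappa> (g c) (u \<circ> chart_inv c)) y = 0"
proof -
  have "smooth_fun A \<Omega> u"
    using sol by (simp add: solution_def)
  then have "smooth_on (chart_map c ` (chart_dom c \<inter> \<Omega>)) (u \<circ> chart_inv c)"
    using c by (simp add: smooth_fun_def)
  then show "smooth_on V (u \<circ> chart_inv c)"
    using V by (rule smooth_on_subset)
  note u = sol [unfolded solution_def, THEN conjunct2, rule_format, OF c]
  show "y \<in> V \<Longrightarrow> 0 < 1 + \<kappa> * (metric_norm (g c) y (gradient (g c) (u \<circ> chart_inv c) y))\<^sup>2"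
    "y \<in> V \<Longrightarrow> divergence (g c) (flux \<kappa> (g c) (u \<circ> chart_inv c)) y = 0"
    using u V by blast+
qed

text \<open>On a coordinate ball the conjugate form is closed and has a primitive \<open>f\<close>.
  The sign and the additive constant are free, and they are fitted to the prescribed value
  \<open>v\<close> at \<open>y\<close>.\<close>

lemma conjugate_section_exists:
  assumes p: "p \<in> \<Omega>"
  shows "\<exists>U. openin (top_of_set \<Omega>) U \<and> p \<in> U \<and> path_connected U \<and>
    (\<forall>y\<in>U. \<forall>v\<in>{1, - 1} \<times> UNIV. \<exists>s. conjugate_section \<kappa> u U s \<and> s y = v)"
proof -
  define c where "c = home_chart p"
  note c = home_chart [OF p, folded c_def]
  obtain r where r: "0 < r" "ball (chart_map c p) r \<subseteq> chart_map c ` (chart_dom c \<inter> \<Omega>)"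
      "openin (top_of_set \<Omega>) (chart_inv c ` ball (chart_map c p) r)" "p \<in> chart_inv c ` ball (chart_map c p) r"
      "chart_inv c ` ball (chart_map c p) r \<subseteq> \<Omega> \<inter> chart_dom c"
    using chart_ball [OF c openin_subtopology_self p] by blast
  define B where "B = ball (chart_map c p) r"
  define U where "U = chart_inv c ` B"
  note r = r(1) r(2-5) [folded B_def, folded U_def]
  have B_image: "B \<subseteq> chart_map c ` chart_dom c"
    using r(2) by blast
  interpret metric_patch B "g c"
    by (rule metric_patch_subset [OF c(1) _ B_image]) (simp add: B_def)
  have smooth: "smooth_on B (flux \<kappa> (g c) (u \<circ> chart_inv c))"
    by (rule smooth_flux [OF solution_on_chart(1,2) [OF c(1) r(2)]])
  obtain f where f: "\<And>x. x \<in> B \<Longrightarrow> (f has_derivative (\<lambda>v. form c x \<bullet> v)) (at x)"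
    using smooth_primitive_on_ball [OF smooth_conjugate_form [OF smooth, unfolded B_def]]
      conjugate_form_closed [OF smooth _ solution_on_chart(3) [OF c(1) r(2)]]
    unfolding B_def by blast
  have "path_connected U"
    unfolding U_def
  proof (rule path_connected_continuous_image)
    show "continuous_on B (chart_inv c)"
      using chart_homeomorphism [OF c(1)] B_image continuous_on_subset by (auto simp: homeomorphism_def)
    show "path_connected B"
      unfolding B_def by (rule convex_imp_path_connected [OF convex_ball])
  qed
  moreover have "\<exists>s. conjugate_section \<kappa> u U s \<and> s y = v" if y: "y \<in> U" and v: "v \<in> {1, - 1} \<times> UNIV" for y v
  proof -
    have sign: "orientation_sign (home_chart q) c q * orientation_sign (home_chart q) c q = 1" if "q \<in> U" for q
      using orientation_sign_values [of "home_chart q" q c] home_chart [of q] that r(5) c(1) by fastforce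
    \<comment> \<open>This is the prescribed orientation \<open>fst v\<close> at \<open>y\<close>,
      rewritten relative to \<open>c\<close>. The definition of \<open>s\<close> converts it back to
      the reference chart at each point; at \<open>y\<close> the two signs cancel.\<close>
    define \<epsilon> where "\<epsilon> = fst v * orientation_sign (home_chart y) c y"
    define s where "s q = (\<epsilon> * orientation_sign (home_chart q) c q,
      \<epsilon> * (f (chart_map c q) - f (chart_map c y)) + snd v)" for q
    have \<epsilon>: "\<epsilon> \<in> {1, - 1}"
      using v orientation_sign_values [of "home_chart y" y c] home_chart [of y] y r(5) c(1)
      by (fastforce simp: \<epsilon>_def)
    have "conjugate_section \<kappa> u U s"
      unfolding conjugate_section_def
    proof (intro conjI ballI impI)
      show "openin (top_of_set \<Omega>) U" by (rule r(3))
    next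
      fix q assume "q \<in> U"
      then show "fst (s q) \<in> {1, - 1}"
        using \<epsilon> orientation_sign_values [of "home_chart q" q c] home_chart [of q] r(5) c(1)
        by (fastforce simp: s_def)
    next
      fix q d assume q: "q \<in> U" and d: "d \<in> A" "q \<in> chart_dom d"
      then have q\<Omega>: "q \<in> \<Omega>" "q \<in> chart_dom c"
        using r(5) by auto
      obtain W where W: "openin (top_of_set \<Omega>) W" "q \<in> W" "W \<subseteq> chart_dom c \<inter> chart_dom d"
          "\<And>q'. q' \<in> W \<Longrightarrow> orientation_sign c d q' = orientation_sign c d q"
        using orientation_sign_locally_constant [OF c(1) q\<Omega>(2) d q\<Omega>(1)] by blast
      show "\<exists>W \<epsilon>. openin (top_of_set \<Omega>) W \<and> q \<in> W \<and> W \<subseteq> U \<inter> chart_dom d \<and>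
          (\<forall>q\<in>W. fst (s q) * orientation_sign (home_chart q) d q = \<epsilon> \<and>
            (snd \<circ> s \<circ> chart_inv d has_derivative (\<lambda>v. \<epsilon> * (form d (chart_map d q) \<bullet> v))) (at (chart_map d q)))"
      \<comment> \<open>On \<open>W\<close> the sign between \<open>c\<close> and \<open>d\<close>
        is constant, so multiplying by it turns the orientation relative to \<open>c\<close> into
        one relative to \<open>d\<close>. The same sign appears when \<open>form c\<close> is pulled
        back to the coordinates of \<open>d\<close>.\<close>
      proof (intro exI [of _ "W \<inter> U"] exI [of _ "\<epsilon> * orientation_sign c d q"] conjI ballI)
        show "openin (top_of_set \<Omega>) (W \<inter> U)"
          using W(1) r(3) by (rule openin_Int)
        show "q \<in> W \<inter> U" "W \<inter> U \<subseteq> U \<inter> chart_dom d"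
          using W q by auto
        fix q' assume q': "q' \<in> W \<inter> U"
        then have dom: "q' \<in> chart_dom c" "q' \<in> chart_dom d" "q' \<in> \<Omega>" "q' \<in> U"
          using W r(5) by auto
        have sgn: "orientation_sign c d q' = orientation_sign c d q"
          using W(4) q' by blast
        have "orientation_sign (home_chart q') d q' = orientation_sign (home_chart q') c q' * orientation_sign c d q'"
          by (rule orientation_sign_cocycle) (use home_chart dom c d in auto)
        then show "fst (s q') * orientation_sign (home_chart q') d q' = \<epsilon> * orientation_sign c d q"
          using sign [OF dom(4)] by (simp add: s_def sgn)
        have "chart_map c q' \<in> B"
          using dom(4) chart_inv(1) [OF c(1)] B_image unfolding U_def by auto
        then have "(f has_derivative (\<lambda>v. form c (chart_map c q') \<bullet> v)) (at (chart_map c q'))"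
          by (rule f)
        then have "((\<lambda>x. f ((chart_map c \<circ> chart_inv d) x)) has_derivative
            (\<lambda>v. form c (chart_map c q') \<bullet> (jacobian d c q' *v v))) (at (chart_map d q'))"
          by (rule has_derivative_compose_at)
            (use transition_has_derivative [of d c q'] c d dom in \<open>auto simp: inv_chart o_def\<close>)
        moreover have "form c (chart_map c q') \<bullet> (jacobian d c q' *v v) =
            orientation_sign c d q * (form d (chart_map d q') \<bullet> v)" for v
        proof -
          have "smooth_fun A \<Omega> u"
            using sol by (simp add: solution_def)
          then have "flux \<kappa> (g c) (u \<circ> chart_inv c) (chart_map c q') =
              jacobian d c q' *v flux \<kappa> (g d) (u \<circ> chart_inv d) (chart_map d q')"
            by (rule flux_jacobian [OF d(1) dom(2) c(1) dom(1) _ dom(3)])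
          then show ?thesis
            using conjugate_form_jacobian [OF d(1) dom(2) c(1) dom(1),
                where Xc = "flux \<kappa> (g d) (u \<circ> chart_inv d)" and Xd = "flux \<kappa> (g c) (u \<circ> chart_inv c)"]
              orientation_sign_inverse [OF c(1) d(1) dom(1,2)]
            by (simp add: sgn)
        qed
        ultimately have "((\<lambda>x. \<epsilon> * (f ((chart_map c \<circ> chart_inv d) x) - f (chart_map c y)) + snd v) has_derivative
            (\<lambda>v. \<epsilon> * (orientation_sign c d q * (form d (chart_map d q') \<bullet> v)))) (at (chart_map d q'))"
          by (auto intro!: derivative_eq_intros)
        then show "(snd \<circ> s \<circ> chart_inv d has_derivative
            (\<lambda>v. \<epsilon> * orientation_sign c d q * (form d (chart_map d q') \<bullet> v))) (at (chart_map d q'))"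
          by (simp add: o_def s_def mult.assoc)
      qed
    qed
    moreover have "s y = v"
      using sign [OF y] by (simp add: s_def \<epsilon>_def prod_eq_iff mult.assoc)
    ultimately show ?thesis
      by blast
  qed
  ultimately show ?thesis
    using r(3,4) by blast
qed

lemma conjugate_section_local:
  assumes "conjugate_section \<kappa> u U s" "p \<in> U" "c \<in> A" "p \<in> chart_dom c"
  obtains W \<epsilon> where "openin (top_of_set \<Omega>) W" "p \<in> W" "W \<subseteq> U \<inter> chart_dom c"
    "\<forall>q\<in>W. fst (s q) * orientation_sign (home_chart q) c q = \<epsilon>"
    "\<forall>q\<in>W. (snd \<circ> s \<circ> chart_inv c has_derivative (\<lambda>v. \<epsilon> * (form c (chart_map c q) \<bullet> v))) (at (chart_map c q))"
proof -
  note assms(1) [unfolded conjugate_section_def, THEN conjunct2, THEN conjunct2, rule_format, OF assms(2-4)]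
  then show ?thesis
    by (elim exE conjE) (rule that, assumption+, blast+)
qed

text \<open>If the orientations relative to one chart differ near \<open>p\<close>, the first
  components differ at every point of a coordinate ball. If they coincide, the second components are
  primitives of the same form and differ by a constant on the ball, which is zero or not.\<close>

lemma conjugate_section_agree:
  assumes s: "conjugate_section \<kappa> u U s" and s': "conjugate_section \<kappa> u U' s'" and p: "p \<in> U" "p \<in> U'"
  shows "\<exists>W. openin (top_of_set \<Omega>) W \<and> p \<in> W \<and> ((\<forall>q\<in>W. s q = s' q) \<or> (\<forall>q\<in>W. s q \<noteq> s' q))"
proof -
  have "p \<in> \<Omega>"
    using s p(1) openin_imp_subset unfolding conjugate_section_def by blast
  define c where "c = home_chart p"
  note c = home_chart [OF \<open>p \<in> \<Omega>\<close>, folded c_def]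
  obtain W \<epsilon> where W: "openin (top_of_set \<Omega>) W" "p \<in> W" "W \<subseteq> U \<inter> chart_dom c"
      "\<forall>q\<in>W. fst (s q) * orientation_sign (home_chart q) c q = \<epsilon>"
      "\<forall>q\<in>W. (snd \<circ> s \<circ> chart_inv c has_derivative (\<lambda>v. \<epsilon> * (form c (chart_map c q) \<bullet> v))) (at (chart_map c q))"
    by (rule conjugate_section_local [OF s p(1) c]) (rule that)
  note W = W(1-3) bspec [OF W(4)] bspec [OF W(5)]
  obtain W' \<epsilon>' where W': "openin (top_of_set \<Omega>) W'" "p \<in> W'" "W' \<subseteq> U' \<inter> chart_dom c"
      "\<forall>q\<in>W'. fst (s' q) * orientation_sign (home_chart q) c q = \<epsilon>'"
      "\<forall>q\<in>W'. (snd \<circ> s' \<circ> chart_inv c has_derivative (\<lambda>v. \<epsilon>' * (form c (chart_map c q) \<bullet> v))) (at (chart_map c q))"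
    by (rule conjugate_section_local [OF s' p(2) c]) (rule that)
  note W' = W'(1-3) bspec [OF W'(4)] bspec [OF W'(5)]
  obtain r where r: "0 < r" "ball (chart_map c p) r \<subseteq> chart_map c ` (chart_dom c \<inter> (W \<inter> W'))"
    "openin (top_of_set \<Omega>) (chart_inv c ` ball (chart_map c p) r)" "p \<in> chart_inv c ` ball (chart_map c p) r"
    "chart_inv c ` ball (chart_map c p) r \<subseteq> (W \<inter> W') \<inter> chart_dom c"
    using chart_ball [OF c openin_Int [OF W(1) W'(1)]] W(2) W'(2) by blast
  let ?B = "ball (chart_map c p) r"
  have "(\<forall>q\<in>chart_inv c ` ?B. s q = s' q) \<or> (\<forall>q\<in>chart_inv c ` ?B. s q \<noteq> s' q)"
  proof (cases "\<epsilon> = \<epsilon>'")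
    case False
    have "s q \<noteq> s' q" if "q \<in> chart_inv c ` ?B" for q
    proof -
      have "q \<in> W" "q \<in> W'"
        using that r(5) by auto
      then show ?thesis
        using W(4) W'(4) False by metis
    qed
    then show ?thesis by blast
  next
    case True
    have fst_eq: "fst (s q) = fst (s' q)" if "q \<in> chart_inv c ` ?B" for q
    proof -
      have q: "q \<in> W" "q \<in> W'" "q \<in> chart_dom c"
        using that r(5) by auto
      then have "q \<in> \<Omega>"
        using W(1) openin_imp_subset by blast
      then have "orientation_sign (home_chart q) c q \<noteq> 0"
        using orientation_sign_values [OF home_chart c(1) q(3)] by auto
      moreover have "fst (s q) * orientation_sign (home_chart q) c q = fst (s' q) * orientation_sign (home_chart q) c q"
        using W(4) W'(4) q True by simp
      ultimately show ?thesis by simp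
    qed
    have "\<exists>k. \<forall>x\<in>?B. snd (s (chart_inv c x)) - snd (s' (chart_inv c x)) = k"
    proof (rule has_derivative_zero_constant [OF convex_ball])
      fix x assume x: "x \<in> ?B"
      then obtain q where q: "q \<in> W" "q \<in> W'" "x = chart_map c q"
        using r(2) by blast
      have "((\<lambda>x. (snd \<circ> s \<circ> chart_inv c) x - (snd \<circ> s' \<circ> chart_inv c) x) has_derivative
          (\<lambda>v. \<epsilon> * (form c x \<bullet> v) - \<epsilon>' * (form c x \<bullet> v))) (at x)"
        unfolding q(3) by (rule has_derivative_diff [OF W(5) [OF q(1)] W'(5) [OF q(2)]])
      then show "((\<lambda>x. snd (s (chart_inv c x)) - snd (s' (chart_inv c x))) has_derivative (\<lambda>h. 0)) (at x within ?B)"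
        using True by (simp add: o_def has_derivative_at_withinI)
    qed
    then obtain k where k: "\<And>x. x \<in> ?B \<Longrightarrow> snd (s (chart_inv c x)) - snd (s' (chart_inv c x)) = k"
      by blast
    show ?thesis
    proof (cases "k = 0")
      case True
      then have "s q = s' q" if "q \<in> chart_inv c ` ?B" for q
        using that k fst_eq by (auto simp: prod_eq_iff)
      then show ?thesis by blast
    next
      case False
      then have "s q \<noteq> s' q" if "q \<in> chart_inv c ` ?B" for q
        using that k by force
      then show ?thesis by blast
    qed
  qed
  then show ?thesis
    using r(3,4) by blast
qed

lemma conjugate_solution:
  assumes "simply_connected \<Omega>"
  obtains w where "solution (- \<kappa>) A g \<Omega> w"
    "parallel_gradient A g \<Omega> w \<Longrightarrow> parallel_gradient A g \<Omega> u"
proof -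
  interpret local_sections \<Omega> "{1, - 1} \<times> (UNIV :: real set)" "conjugate_section \<kappa> u"
  proof
    show "s x \<in> {1, - 1} \<times> UNIV" if "conjugate_section \<kappa> u U s" "x \<in> U" for U s x
      using that by (auto simp: conjugate_section_def mem_Times_iff)
  qed (use conjugate_section_exists conjugate_section_agree in \<open>auto simp: conjugate_section_def\<close>)
  obtain G where G: "\<And>x. x \<in> \<Omega> \<Longrightarrow> \<exists>U s. conjugate_section \<kappa> u U s \<and> x \<in> U \<and> (\<forall>y\<in>U. G y = s y)"
    using global_section [OF assms] by blast
  define w where "w = snd \<circ> G"
  \<comment> \<open>The sign \<epsilon> varies with the point and the chart, so its consequences are
    collected near one point in a form that no longer mentions it.\<close>
  have local: "\<exists>V. metric_patch V (g c) \<and> chart_map c p \<in> V \<and> smooth_on V (w \<circ> chart_inv c) \<and>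
      (\<forall>x\<in>V. 0 < 1 + - \<kappa> * (metric_norm (g c) x (gradient (g c) (w \<circ> chart_inv c) x))\<^sup>2 \<and>
        divergence (g c) (flux (- \<kappa>) (g c) (w \<circ> chart_inv c)) x = 0 \<and>
        ((\<forall>i j. cov_deriv (g c) (gradient (g c) (w \<circ> chart_inv c)) j i x = 0) \<longrightarrow>
          (\<forall>i j. cov_deriv (g c) (gradient (g c) (u \<circ> chart_inv c)) j i x = 0)))"
    if c: "c \<in> A" "p \<in> chart_dom c" and p: "p \<in> \<Omega>" for c p
  proof -
    obtain U s where s: "conjugate_section \<kappa> u U s" "p \<in> U" "\<And>y. y \<in> U \<Longrightarrow> G y = s y"
      using G [OF p] by blast
    obtain W \<epsilon> where W: "openin (top_of_set \<Omega>) W" "p \<in> W" "W \<subseteq> U \<inter> chart_dom c"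
        "\<forall>q\<in>W. fst (s q) * orientation_sign (home_chart q) c q = \<epsilon>"
        "\<forall>q\<in>W. (snd \<circ> s \<circ> chart_inv c has_derivative (\<lambda>v. \<epsilon> * (form c (chart_map c q) \<bullet> v))) (at (chart_map c q))"
      by (rule conjugate_section_local [OF s(1,2) c]) (rule that)
    note W = W(1-3) bspec [OF W(4)] bspec [OF W(5)]
    have "fst (s p) \<in> {1, - 1}" "orientation_sign (home_chart p) c p \<in> {1, - 1}"
      using s orientation_sign_values [OF home_chart [OF p] c] by (auto simp: conjugate_section_def)
    then have \<epsilon>: "\<epsilon> * \<epsilon> = 1"
      using W(4) [OF W(2)] by auto
    define V where "V = chart_map c ` (chart_dom c \<inter> W)"
    have W\<Omega>: "W \<subseteq> \<Omega>"
      by (rule openin_imp_subset [OF W(1)])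
    have V: "open V" "V \<subseteq> chart_map c ` chart_dom c" "V \<subseteq> chart_map c ` (chart_dom c \<inter> \<Omega>)"
      unfolding V_def using open_chart_image [OF c(1) openin_M [OF W(1)]] W\<Omega> by auto
    interpret metric_patch V "g c"
      by (rule metric_patch_subset [OF c(1) V(1,2)])
    have dw: "(w \<circ> chart_inv c has_derivative (\<lambda>v. \<epsilon> * (form c y \<bullet> v))) (at y)" if y: "y \<in> V" for y
    proof -
      obtain q where "q \<in> W" "y = chart_map c q"
        using y unfolding V_def by blast
      then have "(snd \<circ> s \<circ> chart_inv c has_derivative (\<lambda>v. \<epsilon> * (form c y \<bullet> v))) (at y)"
        using W(5) by blast
      moreover have "(snd \<circ> s \<circ> chart_inv c) x = (w \<circ> chart_inv c) x" if "x \<in> V" for x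
        using that W(3) s(3) inv_chart [OF c(1)] unfolding V_def w_def by auto
      ultimately show ?thesis
        by (rule has_derivative_transform_within_open [OF _ V(1) y])
    qed
    note u = solution_on_chart(1,2) [OF c(1) V(3)]
    note conj = u dw \<epsilon>
    show ?thesis
    proof (intro exI [of _ V] conjI ballI impI allI)
      show "metric_patch V (g c)" by unfold_locales
      show "chart_map c p \<in> V" using c W(2) by (auto simp: V_def)
      show "smooth_on V (w \<circ> chart_inv c)"
        by (rule conjugate_smooth [OF conj])
      fix x assume x: "x \<in> V"
      show "0 < 1 + - \<kappa> * (metric_norm (g c) x (gradient (g c) (w \<circ> chart_inv c) x))\<^sup>2"
        by (rule conjugate_pos [OF conj x])
      show "divergence (g c) (flux (- \<kappa>) (g c) (w \<circ> chart_inv c)) x = 0"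
        by (rule conjugate_divergence [OF conj x])
      fix i j assume "\<forall>i j. cov_deriv (g c) (gradient (g c) (w \<circ> chart_inv c)) j i x = 0"
      then show "cov_deriv (g c) (gradient (g c) (u \<circ> chart_inv c)) j i x = 0"
        by (intro conjugate_parallel [OF conj x]) auto
    qed
  qed
  show ?thesis
  proof (rule that)
    have "smooth_fun A \<Omega> w"
      unfolding smooth_fun_def
    proof (intro ballI smooth_on_local)
      fix c x assume c: "c \<in> A" and "x \<in> chart_map c ` (chart_dom c \<inter> \<Omega>)"
      then obtain p where p: "p \<in> chart_dom c" "p \<in> \<Omega>" "x = chart_map c p"
        by blast
      show "\<exists>V. open V \<and> x \<in> V \<and> smooth_on V (w \<circ> chart_inv c)"
        using local [OF c p(1,2)] metric_patch.open_V unfolding p(3) by meson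
    qed
    moreover have "0 < 1 + - \<kappa> * (metric_norm (g c) x (gradient (g c) (w \<circ> chart_inv c) x))\<^sup>2 \<and>
        divergence (g c) (flux (- \<kappa>) (g c) (w \<circ> chart_inv c)) x = 0"
      if c: "c \<in> A" and x: "x \<in> chart_map c ` (chart_dom c \<inter> \<Omega>)" for c x
    proof -
      obtain p where p: "p \<in> chart_dom c" "p \<in> \<Omega>" "x = chart_map c p"
        using x by blast
      then show ?thesis
        using local [OF c p(1,2)] by meson
    qed
    ultimately show "solution (- \<kappa>) A g \<Omega> w"
      by (simp only: solution_def) blast
    show "parallel_gradient A g \<Omega> u" if "parallel_gradient A g \<Omega> w"
      unfolding parallel_gradient_def
    proof (intro ballI allI)
      fix c x i j assume c: "c \<in> A" and x: "x \<in> chart_map c ` (chart_dom c \<inter> \<Omega>)"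
      then have "\<forall>i j. cov_deriv (g c) (gradient (g c) (w \<circ> chart_inv c)) j i x = 0"
        using that unfolding parallel_gradient_def by meson
      moreover obtain p where p: "p \<in> chart_dom c" "p \<in> \<Omega>" "x = chart_map c p"
        using x by blast
      ultimately show "cov_deriv (g c) (gradient (g c) (u \<circ> chart_inv c)) j i x = 0"
        using local [OF c p(1,2)] by meson
    qed
  qed
qed

end

end

theorem theorem5p1:
  fixes M \<Omega> :: "'a::{t2_space,second_countable_topology} set"
    and A :: "'a chart set"
    and g :: "'a chart \<Rightarrow> real^2 \<Rightarrow> real^2^2"
  assumes "riemannian_surface M A g"
    and "connected M"
    and "openin (top_of_set M) \<Omega>"
    and "connected \<Omega>"
    and "simply_connected \<Omega>"
  shows "(\<exists>u. smooth_fun A \<Omega> u \<and> minimal_surface_eq A g \<Omega> u \<and> \<not> parallel_gradient A g \<Omega> u) \<longleftrightarrow>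
         (\<exists>w. smooth_fun A \<Omega> w \<and> maximal_surface_eq A g \<Omega> w \<and> \<not> parallel_gradient A g \<Omega> w)"
proof -
  interpret surface_domain M A g \<Omega>
    using assms(1,3) by (simp add: surface_domain_def surface_domain_axioms_def)
  \<comment> \<open>Non-triviality passes to the conjugate solution by contraposition of the second
    clause of \<open>conjugate_solution\<close>.\<close>
  have conjugate: "\<exists>w. solution (- \<kappa>) A g \<Omega> w \<and> \<not> parallel_gradient A g \<Omega> w"
    if "solution \<kappa> A g \<Omega> u" "\<not> parallel_gradient A g \<Omega> u" for \<kappa> u
    using conjugate_solution [OF that(1) assms(5)] that(2) by metis
  have "(\<exists>u. solution 1 A g \<Omega> u \<and> \<not> parallel_gradient A g \<Omega> u) \<longleftrightarrow>
      (\<exists>w. solution (- 1) A g \<Omega> w \<and> \<not> parallel_gradient A g \<Omega> w)"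
    using conjugate [of 1] conjugate [of "- 1"] by auto
  then show ?thesis
    unfolding minimal_iff_solution [symmetric] maximal_iff_solution [symmetric] by (simp only: conj_assoc)
qed

end
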